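(* Let $n,m,\delta$ be integers with $\delta \geq n$ and $\delta \geq \frac{m+5}{3}$. If $\mathcal{H}$ is a 2-connected hypergraph with $n$ vertices, $m$ edges and minimum degree at least $\delta$, then $\mathcal{H}$ has a hamiltonian Berge cycle.
   Context: A hypergraph $\mathcal{H}$ consists of a vertex set $V(\mathcal{H})$ and an edge set $E(\mathcal{H})$ whose elements are subsets of $V(\mathcal{H})$ (of arbitrary sizes). The degree of a vertex is the number of edges containing it. A Berge cycle of length $\ell$ consists of $\ell$ distinct vertices $v_1,\dots,v_\ell$ and $\ell$ distinct edges $e_1,\dots,e_\ell$ with $v_i, v_{i+1} \in e_i$ for all $i$ (indices mod $\ell$); $v_1,\dots,v_\ell$ are its base vertices. A hamiltonian Berge cycle is a Berge cycle whose set of base vertices is $V(\mathcal{H})$. The incidence graph $I(\mathcal{H})$ is the bipartite graph with parts $X = V(\mathcal{H})$ and $Y = E(\mathcal{H})$, where $v \in X$ is adjacent to $e \in Y$ iff $v \in e$. $\mathcal{H}$ is 2-connected if $I(\mathcal{H})$ is 2-connected. *)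

theory Defs
  imports Complex_Main
begin

definition hypergraph :: "'a set \<Rightarrow> 'a set set \<Rightarrow> bool" where
  "hypergraph V E \<longleftrightarrow> (\<forall>e\<in>E. e \<subseteq> V)"

definition hdegree :: "'a set set \<Rightarrow> 'a \<Rightarrow> nat" where
  "hdegree E v = card {e \<in> E. v \<in> e}"

definition inc_vertices :: "'a set \<Rightarrow> 'a set set \<Rightarrow> ('a + 'a set) set" where
  "inc_vertices V E = Inl ` V \<union> Inr ` E"

definition inc_adj :: "'a set \<Rightarrow> 'a set set \<Rightarrow> ('a + 'a set) \<Rightarrow> ('a + 'a set) \<Rightarrow> bool" where
  "inc_adj V E x y \<longleftrightarrow>
     (\<exists>v e. v \<in> V \<and> e \<in> E \<and> v \<in> e \<and> ((x = Inl v \<and> y = Inr e) \<or> (x = Inr e \<and> y = Inl v)))"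

definition connected_on :: "('b \<Rightarrow> 'b \<Rightarrow> bool) \<Rightarrow> 'b set \<Rightarrow> bool" where
  "connected_on adj S \<longleftrightarrow>
     (\<forall>x\<in>S. \<forall>y\<in>S. (\<lambda>a b. a \<in> S \<and> b \<in> S \<and> adj a b)\<^sup>*\<^sup>* x y)"

definition two_connected_graph :: "('b \<Rightarrow> 'b \<Rightarrow> bool) \<Rightarrow> 'b set \<Rightarrow> bool" where
  "two_connected_graph adj S \<longleftrightarrow>
     finite S \<and> card S \<ge> 3 \<and> connected_on adj S \<and> (\<forall>x\<in>S. connected_on adj (S - {x}))"

definition two_connected_hypergraph :: "'a set \<Rightarrow> 'a set set \<Rightarrow> bool" where
  "two_connected_hypergraph V E \<longleftrightarrow> two_connected_graph (inc_adj V E) (inc_vertices V E)"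

definition berge_cycle :: "'a set \<Rightarrow> 'a set set \<Rightarrow> 'a list \<Rightarrow> 'a set list \<Rightarrow> bool" where
  "berge_cycle V E vs es \<longleftrightarrow>
     length vs \<ge> 1 \<and> length es = length vs \<and> distinct vs \<and> distinct es \<and>
     set vs \<subseteq> V \<and> set es \<subseteq> E \<and>
     (\<forall>i < length vs. vs ! i \<in> es ! i \<and> vs ! ((i + 1) mod length vs) \<in> es ! i)"

definition hamiltonian_berge_cycle :: "'a set \<Rightarrow> 'a set set \<Rightarrow> bool" where
  "hamiltonian_berge_cycle V E \<longleftrightarrow> (\<exists>vs es. berge_cycle V E vs es \<and> set vs = V)"

end

theory Submission
  imports Defs
begin

text \<open>
  Work in the bipartite incidence graph with parts \<^term>\<open>X\<close> (vertices) and \<^term>\<open>Y\<close> (edges). Let \<open>k\<close> be the largest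
  number of \<^term>\<open>X\<close>-vertices on a cycle and suppose that \<open>k < card X\<close>.
  If a path with vertex set \<open>Q\<close> containing more than \<open>k\<close> vertices of \<^term>\<open>X\<close> joins \<open>u\<close> and \<open>v\<close> in \<^term>\<open>X\<close>, then \<open>u\<close> and \<open>v\<close> have
  no common neighbour outside \<open>Q\<close>. So vertices pairwise joined by paths on the same \<open>Q\<close> have disjoint
  neighbourhoods outside \<open>Q\<close>, and since there are at most \<open>3\<delta> - 5\<close> elements of \<^term>\<open>Y\<close>, their degrees into \<open>Q\<close> cannot be
  too small (lemma \<open>count\<close>). The contradictory upper bounds come from the crossing argument of Dirac and Ore: a
  crossing on such a path yields a cycle missing a single vertex of the path.

  Let \<open>b\<close> be the largest number of neighbours on a longest cycle \<open>c\<close> of an \<^term>\<open>X\<close>-vertex missed by \<open>c\<close>.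
  If \<open>b \<le> 1\<close>, there are no crossings at all; a shortest ear of \<open>c\<close> containing an \<^term>\<open>X\<close>-vertex, which exists by
  2-connectivity, then yields a longer cycle.
  If \<open>b \<ge> 2\<close>, take \<open>c\<close> and \<open>x\<close> attaining \<open>b\<close>; then \<open>x\<close> and the successors on \<open>c\<close> of the neighbours of \<open>x\<close> are
  pairwise joined by paths on \<open>c\<close> and \<open>x\<close>. For \<open>k \<ge> 2b - 2\<close> at most four of these vertices suffice for a
  contradiction. For \<open>b < k < 2b - 2\<close> many of them lie between two neighbours of \<open>x\<close>, so that they can be exchanged
  with \<open>x\<close> and have degree at most \<open>b\<close> into \<open>c\<close>. For \<open>b = k\<close> a path from a neighbour of \<open>x\<close> outside \<open>c\<close> back to \<open>c\<close>
  extends \<open>c\<close>.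
\<close>

section \<open>Paths, cycles and crossings in bipartite graphs\<close>

locale bigraph =
  fixes G :: "'a \<Rightarrow> 'a \<Rightarrow> bool" and X Y :: "'a set"
  assumes sym: "G a b \<Longrightarrow> G b a"
    and bip: "G a b \<Longrightarrow> a \<in> X \<and> b \<in> Y \<or> a \<in> Y \<and> b \<in> X"
    and disj: "X \<inter> Y = {}"
    and finX: "finite X" and finY: "finite Y"
begin

definition nbrs :: "'a \<Rightarrow> 'a set" where
  "nbrs v = {w. G v w}"

definition path :: "'a list \<Rightarrow> bool" where
  "path p \<longleftrightarrow> p \<noteq> [] \<and> distinct p \<and> successively G p"

definition cycle :: "'a list \<Rightarrow> bool" where
  "cycle c \<longleftrightarrow> path c \<and> 3 \<le> length c \<and> G (last c) (hd c)"

text \<open>Only the vertex set of the path is recorded: the counting compares several paths that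
  run through the same set \<open>Q\<close> in different orders.\<close>

definition joined :: "'a set \<Rightarrow> 'a \<Rightarrow> 'a \<Rightarrow> bool" where
  "joined Q a b \<longleftrightarrow> (\<exists>p. path p \<and> set p = Q \<and> hd p = a \<and> last p = b)"

lemma X_notin_Y: "a \<in> X \<Longrightarrow> a \<notin> Y"
  using disj by blast

lemma adj_Y: "G a b \<Longrightarrow> a \<in> X \<Longrightarrow> b \<in> Y"
  using bip disj by blast

lemma adj_X: "G a b \<Longrightarrow> a \<in> Y \<Longrightarrow> b \<in> X"
  using bip disj by blast

lemma nbrs_subset: "x \<in> X \<Longrightarrow> nbrs x \<subseteq> Y"
  using adj_Y by (auto simp: nbrs_def)

lemma finite_nbrs: "x \<in> X \<Longrightarrow> finite (nbrs x)"
  using finY nbrs_subset finite_subset by blast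

lemma successively_flip [simp]: "successively (\<lambda>x y. G y x) p \<longleftrightarrow> successively G p"
proof -
  have "(\<lambda>x y. G y x) = G" using sym by blast
  then show ?thesis by (rule arg_cong[where f = "\<lambda>H. successively H p"])
qed

lemma path_Cons: "path (a # B) \<longleftrightarrow> B = [] \<or> a \<notin> set B \<and> G a (hd B) \<and> path B"
  by (auto simp: path_def successively_Cons)

lemma path_append:
  "A \<noteq> [] \<Longrightarrow> B \<noteq> [] \<Longrightarrow>
    path (A @ B) \<longleftrightarrow> path A \<and> path B \<and> set A \<inter> set B = {} \<and> G (last A) (hd B)"
  by (auto simp: path_def successively_append_iff)

lemma path_rev: "path (rev p) \<longleftrightarrow> path p"
  by (simp add: path_def)

lemmas path_simps = path_Cons path_append path_rev hd_rev last_rev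

lemma joinedI: "path p \<Longrightarrow> set p = Q \<Longrightarrow> hd p = a \<Longrightarrow> last p = b \<Longrightarrow> joined Q a b"
  unfolding joined_def by blast

lemma joined_sym: "joined Q a b \<Longrightarrow> joined Q b a"
  unfolding joined_def path_def
  by (metis distinct_rev hd_rev last_rev rev_is_Nil_conv set_rev successively_rev successively_flip)

lemma cycle_rotate:
  assumes "cycle (as @ bs)" shows "cycle (bs @ as)"
  using assms unfolding cycle_def path_def
  by (cases "as = []"; cases "bs = []") (auto simp: successively_append_iff)

lemma cycle_rotate_to_last:
  assumes "cycle c" "a \<in> set c"
  obtains d where "cycle (d @ [a])" "set (d @ [a]) = set c"
proof -
  obtain as bs where c: "c = as @ a # bs" using assms(2) by (meson split_list)
  have "cycle ((as @ [a]) @ bs)" using assms(1) c by simp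
  from cycle_rotate[OF this] that[of "bs @ as"] show thesis using c by auto
qed

text \<open>Vertices alternate between the parts, so the counts can differ only through the ends;
  the two indicator terms cover all four kinds of end pairs in one equation.\<close>

lemma alternating_card:
  assumes "path p" "hd p \<in> X \<union> Y"
  shows "card (set p \<inter> X) + of_bool (hd p \<in> Y) = card (set p \<inter> Y) + of_bool (last p \<in> X)"
  using assms
proof (induction p rule: induct_list012)
  case (3 a b p)
  have ab: "G a b" and pb: "path (b # p)" and a: "a \<notin> set (b # p)"
    using 3(3) by (auto simp: path_def)
  have "b \<in> X \<union> Y" using bip[OF ab] by auto
  then have IH: "card (set (b # p) \<inter> X) + of_bool (b \<in> Y) = card (set (b # p) \<inter> Y) + of_bool (last (b # p) \<in> X)"
    using 3(2) pb by simp
  have ins: "card (set (a # b # p) \<inter> S) = card (set (b # p) \<inter> S) + of_bool (a \<in> S)" for S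
    using a card_insert_disjoint[of "set (b # p) \<inter> S" a] by (cases "a \<in> S") simp_all
  have "a \<in> X \<and> a \<notin> Y \<and> b \<in> Y \<or> a \<in> Y \<and> a \<notin> X \<and> b \<notin> Y"
    using bip[OF ab] disj by blast
  then have "card (set (a # b # p) \<inter> X) + of_bool (a \<in> Y)
      = card (set (a # b # p) \<inter> Y) + of_bool (last (b # p) \<in> X)"
    using IH unfolding ins by auto
  then show ?case by (simp only: list.sel last_ConsR list.distinct not_False_eq_True)
qed (auto simp: path_def Int_insert_left of_bool_def dest: X_notin_Y)

lemma cycle_card:
  assumes "cycle c" shows "card (set c \<inter> X) = card (set c \<inter> Y)"
proof -
  have c: "path c" and G: "G (last c) (hd c)" using assms by (auto simp: cycle_def)
  have "hd c \<in> X \<union> Y" using bip[OF G] by auto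
  from alternating_card[OF c this] show ?thesis using bip[OF G] disj by (auto simp: of_bool_def split: if_splits)
qed

lemma path_card:
  assumes "path p" "hd p \<in> X" "last p \<in> X"
  shows "card (set p \<inter> X) = Suc (card (set p \<inter> Y))"
  using alternating_card[OF assms(1)] assms(2,3) X_notin_Y by auto

section \<open>Successors, predecessors and crossings on a path\<close>

definition nexts :: "'a list \<Rightarrow> 'a set \<Rightarrow> 'a set" where
  "nexts p M = {z. \<exists>A y B. p = A @ [y, z] @ B \<and> y \<in> M}"

definition prevs :: "'a list \<Rightarrow> 'a set \<Rightarrow> 'a set" where
  "prevs p M = {z. \<exists>A y B. p = A @ [z, y] @ B \<and> y \<in> M}"

lemma prevs_rev: "prevs p M = nexts (rev p) M"
proof -
  have 1: "prevs p M \<subseteq> nexts (rev p) M" for p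
  proof
    fix z assume "z \<in> prevs p M"
    then obtain A y B where p: "p = A @ [z, y] @ B" "y \<in> M" by (auto simp: prevs_def)
    then have "rev p = rev B @ [y, z] @ rev A" by simp
    then show "z \<in> nexts (rev p) M" using p(2) unfolding nexts_def by blast
  qed
  have 2: "nexts p M \<subseteq> prevs (rev p) M" for p
  proof
    fix z assume "z \<in> nexts p M"
    then obtain A y B where p: "p = A @ [y, z] @ B" "y \<in> M" by (auto simp: nexts_def)
    then have "rev p = rev B @ [z, y] @ rev A" by simp
    then show "z \<in> prevs (rev p) M" using p(2) unfolding prevs_def by blast
  qed
  show ?thesis using 1[of p] 2[of "rev p"] by simp
qed

text \<open>Taking successors is injective on a path, and only the last vertex has no
  successor.\<close>

lemma card_nexts:
  assumes "path p" "last p \<notin> M"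
  shows "card (nexts p M) = card (M \<inter> set p)"
proof -
  let ?I = "{i. Suc i < length p \<and> p ! i \<in> M}"
  have d: "distinct p" and ne: "p \<noteq> []" using assms by (auto simp: path_def)
  have 1: "nexts p M = (\<lambda>i. p ! Suc i) ` ?I"
  proof (intro equalityI subsetI)
    fix z assume "z \<in> nexts p M"
    then obtain A y B where p: "p = A @ [y, z] @ B" "y \<in> M" by (auto simp: nexts_def)
    have "z = p ! Suc (length A)" "length A \<in> ?I" using p by (auto simp: nth_append)
    then show "z \<in> (\<lambda>i. p ! Suc i) ` ?I" by blast
  next
    fix z assume "z \<in> (\<lambda>i. p ! Suc i) ` ?I"
    then obtain i where i: "Suc i < length p" "p ! i \<in> M" "z = p ! Suc i" by auto
    have "p = take i p @ [p ! i, z] @ drop (Suc (Suc i)) p"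
      using i by (metis Cons_nth_drop_Suc Suc_lessD append_Cons append_Nil append_take_drop_id)
    then show "z \<in> nexts p M" using i(2) unfolding nexts_def by blast
  qed
  have 2: "M \<inter> set p = (\<lambda>i. p ! i) ` ?I"
  proof (intro equalityI subsetI)
    fix y assume y: "y \<in> M \<inter> set p"
    then obtain i where i: "i < length p" "y = p ! i" by (auto simp: in_set_conv_nth)
    have "Suc i \<noteq> length p"
    proof
      assume "Suc i = length p"
      then have "length p - 1 = i" by simp
      then show False using assms(2) i y ne by (simp add: last_conv_nth)
    qed
    then show "y \<in> (\<lambda>i. p ! i) ` ?I" using i y by auto
  qed auto
  have "inj_on (\<lambda>i. p ! Suc i) ?I" "inj_on (\<lambda>i. p ! i) ?I"
    using d by (auto simp: inj_on_def nth_eq_iff_index_eq)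
  then show ?thesis unfolding 1 2 by (simp add: card_image)
qed

lemma card_prevs:
  assumes "path p" "hd p \<notin> M"
  shows "card (prevs p M) = card (M \<inter> set p)"
  using card_nexts[of "rev p" M] assms by (auto simp: prevs_rev path_def last_rev)

lemma nexts_subset:
  assumes "path p" "M \<subseteq> Y" shows "nexts p M \<subseteq> set p \<inter> X"
proof
  fix z assume "z \<in> nexts p M"
  then obtain A y B where p: "p = A @ [y, z] @ B" "y \<in> M" by (auto simp: nexts_def)
  have "G y z" using assms(1) p by (simp_all add: path_def successively_append_iff successively_Cons)
  then show "z \<in> set p \<inter> X" using adj_X p assms(2) by auto
qed

lemma prevs_subset:
  assumes "path p" "M \<subseteq> Y" shows "prevs p M \<subseteq> set p \<inter> X"
  using nexts_subset[of "rev p" M] assms by (simp add: prevs_rev path_def)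

lemma nexts_prevs:
  assumes "path p" "z \<in> nexts p M" "z \<in> prevs p M'"
  obtains A w w' B where "p = A @ [w, z, w'] @ B" "w \<in> M" "w' \<in> M'"
proof -
  obtain A y B where p: "p = A @ [y, z] @ B" "y \<in> M" using assms(2) by (auto simp: nexts_def)
  obtain A' y' B' where p': "p = A' @ [z, y'] @ B'" "y' \<in> M'" using assms(3) by (auto simp: prevs_def)
  have d: "distinct p" using assms(1) by (simp add: path_def)
  have d': "distinct (A' @ [z, y'] @ B')" using d p'(1) by metis
  have "(A @ [y]) @ z # B = A' @ z # (y' # B')" using p p' by simp
  moreover have "z \<notin> set (A @ [y])" "z \<notin> set A'" using d p d' by auto
  moreover have "z \<notin> set B" using d p by auto
  ultimately have "A @ [y] = A' \<and> B = y' # B'"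
    using append_Cons_eq_iff[of z "A @ [y]" B A' "y' # B'"] by auto
  then have "B = y' # B'" by simp
  then show thesis using that p p' by auto
qed

text \<open>The vertices at which a path can be closed up to a cycle through all of its other vertices.\<close>

definition crossing :: "'a list \<Rightarrow> 'a set" where
  "crossing p = nexts p (nbrs (last p)) \<inter> prevs p (nbrs (hd p))"

lemma crossingE:
  assumes "path p" "z \<in> crossing p" "hd p \<in> X" "last p \<in> X"
  obtains A w w' B where "p = A @ [w, z, w'] @ B" "G (last p) w" "G (hd p) w'"
    "A \<noteq> []" "B \<noteq> []" "hd p = hd A" "last p = last B"
proof -
  obtain A w w' B where p: "p = A @ [w, z, w'] @ B" "w \<in> nbrs (last p)" "w' \<in> nbrs (hd p)"
    using nexts_prevs assms unfolding crossing_def by blast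
  have "w \<in> Y" "w' \<in> Y" using p(2,3) assms(3,4) nbrs_subset by auto
  then have "A \<noteq> []" "B \<noteq> []" using p(1) assms(3,4) X_notin_Y by auto
  then show thesis using that p by (auto simp: nbrs_def)
qed

lemma crossing_ends:
  assumes "path p" "z \<in> crossing p" "hd p \<in> X" "last p \<in> X"
  shows "z \<noteq> hd p" "z \<noteq> last p"
proof -
  obtain A w w' B where p: "p = A @ [w, z, w'] @ B" and
    ne: "A \<noteq> []" "B \<noteq> []" "hd p = hd A" "last p = last B" using crossingE[OF assms] .
  have "distinct (A @ [w, z, w'] @ B)" using assms(1) p by (simp add: path_def)
  moreover have "hd A \<in> set A" "last B \<in> set B" using ne by auto
  ultimately show "z \<noteq> hd p" "z \<noteq> last p" unfolding ne(3,4) by auto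
qed

text \<open>Ore's count: the successors of neighbours of \<open>last p\<close> and the predecessors
  of neighbours of \<open>hd p\<close> are both sets of \<open>X\<close>-vertices of
  \<open>p\<close>, so large end degrees force them to overlap.\<close>

lemma card_crossing:
  assumes "path p" "hd p \<in> X" "last p \<in> X"
  shows "card (nbrs (hd p) \<inter> set p) + card (nbrs (last p) \<inter> set p)
    \<le> card (set p \<inter> X) + card (crossing p)"
proof -
  let ?S = "nexts p (nbrs (last p))" and ?T = "prevs p (nbrs (hd p))"
  have sub: "?S \<union> ?T \<subseteq> set p \<inter> X"
    using nexts_subset prevs_subset assms nbrs_subset by (metis Un_least)
  then have fin: "finite ?S" "finite ?T" by (auto intro: finite_subset)
  have "last p \<notin> nbrs (last p)" "hd p \<notin> nbrs (hd p)"
    using assms nbrs_subset X_notin_Y by blast+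
  then have "card ?S = card (nbrs (last p) \<inter> set p)" "card ?T = card (nbrs (hd p) \<inter> set p)"
    using card_nexts card_prevs assms by auto
  moreover have "card ?S + card ?T = card (?S \<union> ?T) + card (?S \<inter> ?T)"
    using card_Un_Int fin by blast
  moreover have "card (?S \<union> ?T) \<le> card (set p \<inter> X)" using sub by (simp add: card_mono)
  ultimately show ?thesis by (simp add: crossing_def)
qed

lemma crossing_cycle:
  assumes "path p" "z \<in> crossing p" "hd p \<in> X" "last p \<in> X"
  obtains c where "cycle c" "set c = set p - {z}"
proof -
  obtain A w w' B where p: "p = A @ [w, z, w'] @ B" and G: "G (last p) w" "G (hd p) w'"
    and ne: "A \<noteq> []" "B \<noteq> []" "hd p = hd A" "last p = last B" using crossingE[OF assms] .
  have P: "path (A @ [w, z, w'] @ B)" using assms(1) p by metis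
  then have "G w' (hd B)" using ne by (simp add: path_simps)
  note G' = sym[OF G(1)] sym[OF G(2)] sym[OF this]
  \<comment> \<open>Go from \<open>hd p\<close> to \<open>w\<close>, jump to \<open>last p\<close>,
    return to \<open>w'\<close> and jump back to \<open>hd p\<close>; only \<open>z\<close> is
    skipped.\<close>
  have "cycle (A @ [w] @ rev B @ [w'])" unfolding cycle_def
    using P G' ne by (auto simp: path_simps Suc_le_eq)
  moreover have "set (A @ [w] @ rev B @ [w']) = set p - {z}"
    using P ne unfolding p by (auto simp: path_simps)
  ultimately show thesis using that by blast
qed

text \<open>The cycle that skips \<open>z\<close> uses the edges from \<open>hd p\<close> to
  \<open>w'\<close> and from \<open>last p\<close> to \<open>w\<close>. Deleting the first and
  attaching \<open>z\<close> at \<open>w'\<close>, or deleting the second and attaching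
  \<open>z\<close> at \<open>w\<close>, gives the two paths.\<close>

lemma crossing_joined:
  assumes "path p" "z \<in> crossing p" "hd p \<in> X" "last p \<in> X"
  shows "joined (set p) (hd p) z" "joined (set p) z (last p)"
proof -
  obtain A w w' B where p: "p = A @ [w, z, w'] @ B" and G: "G (last p) w" "G (hd p) w'"
    and ne: "A \<noteq> []" "B \<noteq> []" "hd p = hd A" "last p = last B" using crossingE[OF assms] .
  have P: "path (A @ [w, z, w'] @ B)" using assms(1) p by metis
  then have "G w' (hd B)" "G (last A) w" "G w z" "G z w'" using ne by (simp_all add: path_simps)
  note G' = this[THEN sym] G[THEN sym]
  have "path (A @ [w] @ rev B @ [w', z])" using P G' ne by (auto simp: path_simps)
  then show "joined (set p) (hd p) z"
    by (rule joinedI) (use p ne in auto)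
  have "path ([z, w] @ rev A @ [w'] @ B)" using P G' G(2) ne by (auto simp: path_simps)
  then show "joined (set p) z (last p)"
    by (rule joinedI) (use p ne in auto)
qed

lemma crossing_split:
  assumes "path p" "z \<in> crossing p" "hd p \<in> X" "last p \<in> X" "p = L @ z # R"
  obtains A w w' B where "L = A @ [w]" "R = w' # B" "A \<noteq> []" "B \<noteq> []"
    "G (last p) w" "G (hd p) w'" "w \<in> Y" "w' \<in> Y"
proof -
  obtain A w w' B where p: "p = A @ [w, z, w'] @ B" "G (last p) w" "G (hd p) w'"
    "A \<noteq> []" "B \<noteq> []" using crossingE[OF assms(1-4)] .
  have d: "distinct (A @ [w, z, w'] @ B)" "distinct (L @ z # R)"
    using assms(1) p(1) assms(5) unfolding path_def by metis+
  then have "z \<notin> set (A @ [w])" "z \<notin> set (w' # B)" by auto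
  moreover have "(A @ [w]) @ z # (w' # B) = L @ z # R" using p(1) assms(5) by simp
  ultimately have "L = A @ [w] \<and> R = w' # B"
    using append_Cons_eq_iff[of z "A @ [w]" "w' # B" L R] by blast
  then show thesis using that p adj_Y assms(3,4) by blast
qed

text \<open>Go from \<open>z\<close> back to \<open>hd p\<close>, across to its neighbour just after
  \<open>z\<close>, forward to the neighbour of \<open>last p\<close> just before \<open>z'\<close>,
  across to \<open>last p\<close> and back to \<open>z'\<close>.\<close>

lemma crossing_pair_joined_ordered:
  assumes "path p" "z \<in> crossing p" "z' \<in> crossing p" "hd p \<in> X" "last p \<in> X"
    and p: "p = L @ z # M @ z' # R"
  shows "joined (set p) z z'"
proof -
  obtain A w w' B where 1: "L = A @ [w]" "M @ z' # R = w' # B" "A \<noteq> []"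
      "G (hd p) w'" "w' \<in> Y"
    using crossing_split[OF assms(1,2,4,5), of L "M @ z' # R"] p by metis
  have p2: "p = (L @ z # M) @ z' # R" using p by simp
  obtain A' v v' B' where 2: "L @ z # M = A' @ [v]" "R = v' # B'" "B' \<noteq> []"
      "G (last p) v" "v \<in> Y"
    using crossing_split[OF assms(1,3,4,5) p2] by metis
  have "z \<in> X" "z' \<in> X"
    using assms(1-5) prevs_subset nbrs_subset unfolding crossing_def by blast+
  then have "M \<noteq> []" using 1(2,5) X_notin_Y by (cases M) auto
  then have M: "M \<noteq> []" "hd M = w'" "last M = v"
    using arg_cong[OF 1(2), of hd] arg_cong[OF 2(1), of last] by simp_all
  have p': "p = A @ [w, z] @ M @ [z', v'] @ B'" using p 1(1) 2(2) by simp
  then have P: "path (A @ [w, z] @ M @ [z', v'] @ B')" using assms(1) by metis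
  have hl: "hd p = hd A" "last p = last B'" using 1(3) 2(3) p' by auto
  have "G (last A) w" "G w z" "G v z'" "G z' v'" "G v' (hd B')"
    using P 1(3) 2(3) M by (simp_all add: path_simps)
  note G' = this[THEN sym] 1(4)[THEN sym] 2(4)[THEN sym] 1(4)
  have "path ([z, w] @ rev A @ M @ rev B' @ [v', z'])"
    using P G' 1(3) 2(3) M unfolding hl by (auto simp: path_simps)
  then show ?thesis by (rule joinedI) (auto simp: p')
qed

lemma crossing_pair_joined:
  assumes "path p" "z \<in> crossing p" "z' \<in> crossing p" "hd p \<in> X" "last p \<in> X" "z \<noteq> z'"
  shows "joined (set p) z z'"
proof -
  have "crossing p \<subseteq> set p" unfolding crossing_def nexts_def by auto
  then obtain L R where p: "p = L @ z # R" using assms(2) by (meson split_list subsetD)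
  have "z' \<in> set L \<or> z' \<in> set R"
    using \<open>crossing p \<subseteq> set p\<close> assms(3,6) p by auto
  then show ?thesis
  proof
    assume "z' \<in> set R"
    then obtain M R' where "R = M @ z' # R'" by (meson split_list)
    then show ?thesis using crossing_pair_joined_ordered assms p by simp
  next
    assume "z' \<in> set L"
    then obtain L' M where "L = L' @ z' # M" by (meson split_list)
    then have "p = L' @ z' # M @ z # R" using p by simp
    then show ?thesis using crossing_pair_joined_ordered assms joined_sym by metis
  qed
qed

section \<open>Ears\<close>

lemma path_subset:
  assumes "path p" "hd p \<in> X \<union> Y" shows "set p \<subseteq> X \<union> Y"
  using assms
proof (induction p)
  case (Cons a p)
  show ?case
  proof (cases "p = []")
    case False
    then have "path p" "G a (hd p)" using Cons.prems by (auto simp: path_Cons)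
    then show ?thesis using Cons bip[of a "hd p"] by auto
  qed (use Cons in auto)
qed simp

lemma cycle_subset: "cycle c \<Longrightarrow> set c \<subseteq> X \<union> Y"
  unfolding cycle_def using path_subset bip by blast

lemma path_to_set:
  assumes "connected_on G S" "a \<in> S" "a \<notin> T" "T \<subseteq> S" "T \<noteq> {}"
  obtains R t where "path R" "hd R = a" "set R \<subseteq> S - T" "t \<in> T" "G (last R) t"
proof -
  let ?P = "\<lambda>R. path R \<and> hd R = a \<and> set R \<subseteq> S - T"
  obtain t where t: "t \<in> T" using assms(5) by blast
  then have "(\<lambda>a b. a \<in> S \<and> b \<in> S \<and> G a b)\<^sup>*\<^sup>* a t"
    using assms(1,2,4) unfolding connected_on_def by blast
  \<comment> \<open>Along the walk to \<open>t\<close>, either the current vertex ends a path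
    avoiding \<open>T\<close>, or \<open>T\<close> has been touched already.\<close>
  then have "(\<exists>R. ?P R \<and> last R = t) \<or> (\<exists>R t'. ?P R \<and> t' \<in> T \<and> G (last R) t')"
  proof (induction rule: rtranclp_induct)
    case base
    have "?P [a] \<and> last [a] = a" using assms(2,3) by (simp add: path_def)
    then show ?case by blast
  next
    case (step v w)
    show ?case
    proof (cases "\<exists>R t'. ?P R \<and> t' \<in> T \<and> G (last R) t'")
      case False
      then obtain R where R: "?P R" "last R = v" using step.IH by blast
      have w: "w \<in> S - T" using step.hyps(2) R False by blast
      show ?thesis
      proof (cases "w \<in> set R")
        case True
        then obtain A B where AB: "R = (A @ [w]) @ B" by (metis append.assoc append_Cons append_Nil split_list)
        then have "?P (A @ [w])" using R(1)
          by (auto simp: path_def successively_append_iff hd_append split: if_splits)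
        then show ?thesis by (metis last_snoc)
      next
        case False
        have "R \<noteq> []" using R(1) by (simp add: path_def)
        then have "?P (R @ [w])" using R w False step.hyps(2) by (simp add: path_simps)
        then show ?thesis by (metis last_snoc)
      qed
    qed blast
  qed
  then show thesis
  proof (elim disjE exE conjE)
    fix R assume "path R" "set R \<subseteq> S - T" "last R = t"
    then show thesis using t by (metis DiffD2 last_in_set path_def subsetD)
  qed (rule that)
qed

text \<open>\<open>R\<close> holds only the inner vertices of the ear, which must include one of
  \<open>X\<close>: such an ear can carry a new \<open>X\<close>-vertex into a cycle.\<close>

definition ear :: "'a list \<Rightarrow> 'a list \<Rightarrow> 'a \<Rightarrow> 'a \<Rightarrow> bool" where
  "ear c R p q \<longleftrightarrow> path R \<and> set R \<inter> set c = {} \<and> set R \<inter> X \<noteq> {} \<and> p \<in> set c \<and> q \<in> set c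
    \<and> p \<noteq> q \<and> G p (hd R) \<and> G (last R) q"

lemma ear_Cons:
  assumes "path (y # R)" "set (y # R) \<inter> set c = {}" "set (y # R) \<inter> X \<noteq> {}"
    "p \<in> set c" "q \<in> set c" "p \<noteq> q" "G y p" "G (last (y # R)) q"
  shows "ear c (y # R) p q"
  using assms sym[OF assms(7)] by (simp add: ear_def)

text \<open>A path from \<open>x\<close> reaches \<open>c\<close> in \<open>p\<close>; deleting
  \<open>p\<close> leaves a second route from near its end to another vertex of \<open>c\<close>.
  The cases ensure that the ear meets \<open>X\<close>.\<close>

lemma ear_exists:
  assumes 2: "two_connected_graph G (X \<union> Y)" and c: "cycle c" and x: "x \<in> X" "x \<notin> set c"
  obtains R p q where "ear c R p q"
proof -
  let ?S = "X \<union> Y"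
  have con: "connected_on G ?S" and conv: "\<And>v. v \<in> ?S \<Longrightarrow> connected_on G (?S - {v})"
    using 2 by (auto simp: two_connected_graph_def)
  have cS: "set c \<subseteq> ?S" using c by (rule cycle_subset)
  have "3 \<le> card (set c)" using c by (simp add: cycle_def path_def distinct_card)
  then have rest: "set c - {v} \<noteq> {}" for v
    using card_mono[of "{v}" "set c"] by auto
  obtain R0 p where R0: "path R0" "hd R0 = x" "set R0 \<subseteq> ?S - set c" "p \<in> set c" "G (last R0) p"
    by (rule path_to_set[OF con _ x(2) cS]) (use x rest in auto)
  have R0ne: "R0 \<noteq> []" using R0(1) by (simp add: path_def)
  have avoid: "\<exists>R q. path R \<and> hd R = a \<and> set R \<inter> set c = {} \<and> v \<notin> set R \<and> q \<in> set c \<and> q \<noteq> v \<and> G (last R) q"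
    if av: "a \<in> ?S" "a \<notin> set c" "v \<in> ?S" "a \<noteq> v" for a v
  proof -
    obtain R q where R: "path R" "hd R = a" "set R \<subseteq> (?S - {v}) - (set c - {v})" "q \<in> set c - {v}" "G (last R) q"
      by (rule path_to_set[OF conv[OF av(3)], of a "set c - {v}"]) (use av cS rest in auto)
    then show ?thesis by blast
  qed
  have pS: "p \<in> ?S" using R0(4) cS by blast
  have lS: "last R0 \<in> ?S" "last R0 \<notin> set c" using R0(3) R0ne last_in_set by blast+
  show thesis
  proof (cases "last R0 \<in> X")
    case True
    obtain R q where R: "path R" "hd R = last R0" "set R \<inter> set c = {}" "p \<notin> set R" "q \<in> set c" "q \<noteq> p" "G (last R) q"
      using avoid[OF lS pS] R0(4) lS by metis
    have "R \<noteq> []" using R(1) by (simp add: path_def)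
    then have "hd R \<in> set R \<inter> X" using R(2) True hd_in_set[of R] by simp
    then have "ear c R p q" using R R0(4) sym[OF R0(5)] unfolding ear_def by auto
    then show thesis by (rule that)
  next
    case False
    \<comment> \<open>The last vertex before \<open>c\<close> is now in \<open>Y\<close>; the second
      route starts at its predecessor \<open>x0\<close>, which is in \<open>X\<close>.\<close>
    let ?y = "last R0"
    have yY: "?y \<in> Y" using lS False by blast
    have pX: "p \<in> X" using R0(5) yY adj_X by blast
    have "R0 = butlast R0 @ [?y]" using R0ne by simp
    moreover have ne: "butlast R0 \<noteq> []"
    proof
      assume "butlast R0 = []"
      then have "R0 = [?y]" using R0ne by (metis append_Nil append_butlast_last_id)
      then show False using R0(2) x(1) False by (metis list.sel(1))
    qed
    ultimately have x0y: "G (last (butlast R0)) ?y" using R0(1) path_append[OF ne, of "[?y]"] by simp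
    define x0 where "x0 = last (butlast R0)"
    have x0: "x0 \<in> X" "x0 \<notin> set c" "x0 \<in> ?S" "G ?y x0"
    proof -
      show "x0 \<in> X" using adj_X[OF sym[OF x0y] yY] by (simp add: x0_def)
      have "x0 \<in> set R0" using last_in_set[OF ne] in_set_butlastD[of _ R0] by (auto simp: x0_def)
      then show "x0 \<notin> set c" "x0 \<in> ?S" using R0(3) by blast+
      show "G ?y x0" using sym[OF x0y] by (simp add: x0_def)
    qed
    have "x0 \<noteq> p" using x0(2) R0(4) by blast
    then obtain R q where R: "path R" "hd R = x0" "set R \<inter> set c = {}" "p \<notin> set R" "q \<in> set c" "q \<noteq> p" "G (last R) q"
      using avoid[OF x0(3,2) pS] by metis
    have Rne: "R \<noteq> []" using R(1) by (simp add: path_def)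
    show thesis
    proof (cases "?y \<in> set R")
      case False
      have "hd R \<in> set R" using Rne by simp
      then have "ear c (?y # R) p q" using R R0(4,5) False x0 lS Rne
        by (intro ear_Cons) (auto simp: path_Cons)
      then show thesis by (rule that)
    next
      case True
      \<comment> \<open>The route returns through \<open>?y\<close>; if it goes beyond
        \<open>?y\<close>, the part from \<open>?y\<close> on is an ear.\<close>
      then obtain R1 R2 where R12: "R = R1 @ ?y # R2" by (meson split_list)
      have P2: "path (?y # R2)" using R(1) R12 by (auto simp: path_def successively_append_iff)
      have d2: "set (?y # R2) \<inter> set c = {}" "last (?y # R2) = last R" using R(3) R12 by auto
      show thesis
      proof (cases "R2 = []")
        case False
        then have "G ?y (hd R2)" using P2 by (simp add: path_Cons)
        then have "hd R2 \<in> set (?y # R2) \<inter> X" using adj_X[of ?y "hd R2"] yY False by simp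
        then have "ear c (?y # R2) p q" using P2 d2 R R0(4,5) by (intro ear_Cons) auto
        then show thesis by (rule that)
      next
        case True
        \<comment> \<open>Now \<open>?y\<close> has two neighbours \<open>p\<close> and
          \<open>q\<close> on \<open>c\<close>, and a route from \<open>x0\<close> avoiding
          \<open>?y\<close> ends at a vertex that differs from one of them.\<close>
        then have yq: "G ?y q" using R(7) R12 by simp
        have "x0 \<noteq> ?y" using x0(1) False by blast
        then obtain R' q' where R': "path R'" "hd R' = x0" "set R' \<inter> set c = {}" "?y \<notin> set R'" "q' \<in> set c" "G (last R') q'"
          using avoid[OF x0(3,2) lS(1)] by metis
        have R'ne: "R' \<noteq> []" using R'(1) by (simp add: path_def)
        have "hd R' \<in> set R'" using R'ne by simp
        then have P': "path (?y # R')" "set (?y # R') \<inter> set c = {}" "set (?y # R') \<inter> X \<noteq> {}" "G (last (?y # R')) q'"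
          using R' x0 lS R'ne by (auto simp: path_Cons)
        then have "ear c (?y # R') p q' \<or> ear c (?y # R') q q'"
          using ear_Cons[OF P'(1-3) _ R'(5)] R0(4,5) R(5,6) yq P'(4) by metis
        then show thesis using that by blast
      qed
    qed
  qed
qed

section \<open>Combining a cycle with an ear\<close>

lemma cycle_close:
  assumes "path W" "path S" "set W \<inter> set S = {}" "y \<notin> set W" "y \<notin> set S"
    "G (last W) (hd S)" "G (last S) y" "G y (hd W)"
  shows "cycle (W @ S @ [y])"
proof -
  have "W \<noteq> []" "S \<noteq> []" using assms(1,2) by (auto simp: path_def)
  then have "1 \<le> length W" "1 \<le> length S" by (simp_all add: Suc_le_eq)
  then show ?thesis using assms by (auto simp: cycle_def path_def successively_append_iff)
qed

lemma cycle_absorb_ear: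
  assumes "cycle (D @ [q])" "path R" "set R \<inter> set (D @ [q]) = {}" "G (last D) (hd R)" "G (last R) q" "D \<noteq> []"
  shows "cycle (q # D @ R)"
proof -
  have "cycle ([q] @ D)" using assms(1) by (rule cycle_rotate)
  then show ?thesis using assms(2-6)
    by (auto simp: cycle_def path_def successively_append_iff successively_Cons)
qed

text \<open>Cut the cycle after \<open>q\<close> and after \<open>p\<close>, leaving out the next
  vertex if it lies in \<open>Y\<close>; both segments then start in \<open>X\<close>, and
  \<open>A @ rev R @ rev B\<close> keeps all \<open>X\<close>-vertices of \<open>c\<close>. If the
  vertex left out is the other end of the ear, \<open>p\<close> and \<open>q\<close> are consecutive
  on the cycle and \<open>R\<close> fits between them.\<close>

lemma ear_decomposition:
  assumes c: "cycle c" and ear: "ear c R p q"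
  obtains (absorbed) d where "cycle d" "set c \<union> set R \<subseteq> set d"
  | (split) A f B g where "cycle (A @ f @ B @ g)" "set (A @ f @ B @ g) = set c"
      "A \<noteq> []" "B \<noteq> []" "last A = q" "last B = p"
      "f = [] \<or> (\<exists>y\<in>Y. f = [y])" "g = [] \<or> (\<exists>y\<in>Y. g = [y])" "hd A \<in> X" "hd B \<in> X"
proof -
  have e: "path R" "set R \<inter> set c = {}" "p \<in> set c" "q \<in> set c" "p \<noteq> q" "G p (hd R)" "G (last R) q"
    using ear by (auto simp: ear_def)
  obtain d where d: "cycle (d @ [p])" "set (d @ [p]) = set c" using cycle_rotate_to_last[OF c e(3)] .
  have dne: "d \<noteq> []" using d(1) by (auto simp: cycle_def)
  have pXY: "p \<in> X \<union> Y" using cycle_subset[OF c] e(3) by blast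
  obtain D g where D: "cycle (D @ g)" "set (D @ g) = set c" "D \<noteq> []" "last D = p" "hd D \<in> X"
    "g = [] \<or> (\<exists>y\<in>Y. g = [y])"
  proof (cases "p \<in> Y")
    case True
    then have "hd (d @ [p]) \<in> X" using d(1) adj_X by (auto simp: cycle_def)
    then show thesis using that[of "d @ [p]" "[]"] d by simp
  next
    case False
    then have pX: "p \<in> X" using pXY by blast
    obtain y d' where d': "d = y # d'" using dne by (cases d) auto
    have yY: "y \<in> Y" using d(1) d' pX adj_Y by (auto simp: cycle_def)
    have "cycle ([y] @ (d' @ [p]))" using d(1) d' by simp
    then have "cycle ((d' @ [p]) @ [y])" by (rule cycle_rotate)
    moreover have "hd (d' @ [p]) \<in> X" using d(1) d' yY adj_X by (auto simp: cycle_def path_Cons)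
    ultimately show thesis using that[of "d' @ [p]" "[y]"] d(2) d' yY by auto
  qed
  have "q \<in> set D \<or> q \<in> set g" using D(2) e(4) by auto
  then consider "g = [q]" | D1 D2 where "D = D1 @ q # D2" using D(6) by (metis empty_iff list.set(1) set_ConsD split_list)
  then show thesis
  proof cases
    case 1
    then have "cycle (q # D @ R)" using D e by (intro cycle_absorb_ear) auto
    moreover have "set c \<union> set R \<subseteq> set (q # D @ R)" using D(2) 1 by auto
    ultimately show thesis by (rule absorbed)
  next
    case 2
    have D2: "D2 \<noteq> []" "last D2 = p" using D(4) 2 e(5) by (auto split: if_splits)
    have P: "path (D1 @ q # D2)" using D(1) 2 by (auto simp: cycle_def path_def successively_append_iff successively_Cons)
    then have qD2: "G q (hd D2)" "path D2" using D2 by (auto simp: path_def successively_append_iff successively_Cons)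
    have hdA: "hd (D1 @ [q]) \<in> X" using D(5) 2 by (cases D1) auto
    show thesis
    proof (cases "q \<in> Y")
      case True
      then have "hd D2 \<in> X" using qD2 adj_X by blast
      then show thesis using split[of "D1 @ [q]" "[]" D2 g] D D2 2 hdA by simp
    next
      case False
      then have "q \<in> X" using cycle_subset[OF c] e(4) by blast
      then have y: "hd D2 \<in> Y" using qD2 adj_Y by blast
      obtain y D3 where D3: "D2 = y # D3" using D2 by (cases D2) auto
      show thesis
      proof (cases "D3 = []")
        case True
        then have py: "D2 = [p]" using D2 D3 by simp
        then have "p \<in> Y" using y by simp
        have "g = []"
        proof (rule ccontr)
          assume "g \<noteq> []"
          then obtain y' where "y' \<in> Y" "g = [y']" using D(6) by blast
          then have "G p y'" using D(1) 2 py by (auto simp: cycle_def path_def successively_append_iff)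
          then show False using \<open>p \<in> Y\<close> \<open>y' \<in> Y\<close> adj_X X_notin_Y by blast
        qed
        then have "cycle ((D1 @ [q]) @ [p])" using D(1) 2 py by simp
        moreover have "set (D1 @ [q] @ [p]) = set c" using D(2) 2 py \<open>g = []\<close> by auto
        ultimately have "cycle (p # (D1 @ [q]) @ rev R)"
          using e sym[OF e(6)] sym[OF e(7)] by (intro cycle_absorb_ear) (auto simp: path_rev hd_rev last_rev path_def)
        moreover have "set c \<union> set R \<subseteq> set (p # (D1 @ [q]) @ rev R)"
          using \<open>set (D1 @ [q] @ [p]) = set c\<close> by auto
        ultimately show thesis by (rule absorbed)
      next
        case False
        then have "G y (hd D3)" using qD2 D3 by (simp add: path_Cons)
        then have "hd D3 \<in> X" using adj_X y D3 by auto
        moreover have "last D3 = p" using D2 D3 False by simp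
        ultimately show thesis using split[of "D1 @ [q]" "[y]" D3 g] D D3 2 hdA False y by simp
      qed
    qed
  qed
qed

end

section \<open>Graphs without a cycle through all of X\<close>

locale extremal_bigraph = bigraph +
  fixes \<delta> k b :: nat
  assumes degree: "x \<in> X \<Longrightarrow> \<delta> \<le> card (nbrs x)"
    and k_less: "k < \<delta>"
    and cardY: "card Y + 5 \<le> 3 * \<delta>"
    and k_ge: "2 \<le> k"
    and longest: "cycle c \<Longrightarrow> card (set c \<inter> X) \<le> k"
    and missed: "cycle c \<Longrightarrow> card (set c \<inter> X) = k \<Longrightarrow> x \<in> X \<Longrightarrow> x \<notin> set c
      \<Longrightarrow> card (nbrs x \<inter> set c) \<le> b"
begin

lemma no_longer_cycle:
  assumes "cycle c" "A \<subseteq> set c" "k < card (A \<inter> X)" shows False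
proof -
  have "card (A \<inter> X) \<le> card (set c \<inter> X)" using assms(2) by (intro card_mono) auto
  then show False using longest[OF assms(1)] assms(3) by simp
qed

lemma joined_disjoint:
  assumes "joined Q u v" "u \<in> X" "v \<in> X" "u \<noteq> v" "k < card (Q \<inter> X)"
  shows "nbrs u \<inter> nbrs v \<subseteq> Q"
proof (rule ccontr)
  assume "\<not> ?thesis"
  then obtain y where y: "G u y" "G v y" "y \<notin> Q" by (auto simp: nbrs_def)
  obtain p where p: "path p" "set p = Q" "hd p = u" "last p = v"
    using assms(1) by (auto simp: joined_def)
  have "2 \<le> length p" using p assms(4) by (cases p; cases "tl p") (auto simp: path_def)
  then have "cycle (p @ [y])" using p y sym[OF y(1)]
    by (auto simp: cycle_def path_def successively_append_iff hd_append)
  then show False using no_longer_cycle[of "p @ [y]" Q] p(2) assms(5) by auto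
qed

lemma degree_split:
  assumes "x \<in> X" shows "\<delta> \<le> card (nbrs x - Q) + card (nbrs x \<inter> Q)"
  using degree[OF assms] card_Un_disjoint[of "nbrs x - Q" "nbrs x \<inter> Q"] finite_nbrs[OF assms]
  by (simp add: Un_Diff_Int Diff_Int_distrib2 Int_Diff_disjoint Un_commute)

text \<open>The parts of the neighbourhoods outside \<open>Q\<close> are disjoint subsets of
  \<open>Y - Q\<close>, so their sizes add up to at most its size.\<close>

lemma count:
  assumes "D \<subseteq> X" "finite Q" "\<And>u v. u \<in> D \<Longrightarrow> v \<in> D \<Longrightarrow> u \<noteq> v \<Longrightarrow> nbrs u \<inter> nbrs v \<subseteq> Q"
  shows "card D * \<delta> + card (Q \<inter> Y) + 5 \<le> 3 * \<delta> + (\<Sum>u\<in>D. card (nbrs u \<inter> Q))"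
proof -
  have finD: "finite D" using assms(1) finX finite_subset by blast
  have "(\<Sum>u\<in>D. card (nbrs u - Q)) = card (\<Union>u\<in>D. nbrs u - Q)"
    using assms finD finite_nbrs by (subst card_UN_disjoint) blast+
  also have "\<dots> \<le> card (Y - Q)"
    using assms(1) nbrs_subset finY by (intro card_mono) blast+
  also have "card (Y - Q) = card Y - card (Q \<inter> Y)"
    using finY by (metis card_Diff_subset_Int finite_Int inf_commute)
  finally have 1: "(\<Sum>u\<in>D. card (nbrs u - Q)) + card (Q \<inter> Y) \<le> card Y"
    using card_mono[OF finY, of "Q \<inter> Y"] by simp
  have "card D * \<delta> = (\<Sum>u\<in>D. \<delta>)" by simp
  also have "\<dots> \<le> (\<Sum>u\<in>D. card (nbrs u - Q) + card (nbrs u \<inter> Q))"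
    using assms(1) degree_split by (intro sum_mono) blast
  finally show ?thesis using 1 cardY by (simp add: sum.distrib)
qed

text \<open>\<open>c\<close> covers \<open>k\<close> vertices of \<open>X\<close> and misses
  \<open>z\<close>, so \<open>missed\<close> applies; \<open>z\<close> is not its own
  neighbour.\<close>

lemma removable_degree:
  assumes "cycle c" "set c = Q - {z}" "z \<in> Q" "z \<in> X" "card (Q \<inter> X) = Suc k"
  shows "card (nbrs z \<inter> Q) \<le> b"
proof -
  have "set c \<inter> X = Q \<inter> X - {z}" using assms by auto
  then have "card (set c \<inter> X) = k" using assms by simp
  moreover have "nbrs z \<inter> Q = nbrs z \<inter> set c" using assms nbrs_subset X_notin_Y by blast
  ultimately show ?thesis using missed[OF assms(1)] assms by simp
qed

section \<open>The case \<open>b \<le> 1\<close>: no crossings and no ears\<close>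

lemma no_crossing:
  assumes "b \<le> 1" "path p" "hd p \<in> X" "last p \<in> X" "k < card (set p \<inter> X)"
  shows "crossing p = {}"
proof (rule ccontr)
  assume "\<not> ?thesis"
  then obtain z where z: "z \<in> crossing p" by blast
  obtain c where c: "cycle c" "set c = set p - {z}" 
    using crossing_cycle[OF assms(2) z assms(3,4)] .
  obtain A w w' B where p: "p = A @ [w, z, w'] @ B"
    using crossingE[OF assms(2) z assms(3,4)] by metis
  have zX: "z \<in> X" using assms(2-4) z prevs_subset nbrs_subset unfolding crossing_def by blast
  have P: "path (A @ [w, z, w'] @ B)" using assms(2) p by metis
  have zp: "z \<in> set p" using p by simp
  have "set c \<inter> X = set p \<inter> X - {z}" using c by auto
  then have "card (set p \<inter> X) = Suc k"
    using longest[OF c(1)] assms(5) zp zX by simp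
  then have "card (nbrs z \<inter> set p) \<le> 1"
    using removable_degree[OF c zp zX] assms(1) by linarith
  \<comment> \<open>The cycle skipping \<open>z\<close> contains both path neighbours of
    \<open>z\<close>, which is more than \<open>b\<close> allows.\<close>
  moreover have "w \<noteq> w'" using P by (auto simp: path_def)
  moreover have "G w z" "G z w'" using P by (auto simp: path_def successively_append_iff)
  then have "{w, w'} \<subseteq> nbrs z \<inter> set p" using sym[of w z] p by (auto simp: nbrs_def)
  ultimately show False using card_mono[of "nbrs z \<inter> set p" "{w, w'}"] by simp
qed

text \<open>Otherwise \<open>t\<close> and the two ends have pairwise disjoint neighbourhoods
  outside \<open>p\<close>. Without crossings the end degrees into \<open>p\<close> sum to at most
  \<open>card (set p \<inter> X)\<close>, which together with 3 for \<open>t\<close> falls short by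
  one in \<open>count\<close>.\<close>

lemma shared_neighbour:
  assumes "b \<le> 1" "path p" "hd p \<in> X" "last p \<in> X" "hd p \<noteq> last p" "k < card (set p \<inter> X)"
    and "t \<in> X" "card (nbrs t \<inter> set p) \<le> 3" "t \<noteq> hd p" "t \<noteq> last p"
  obtains y where "y \<notin> set p" "G t y" "G (hd p) y \<or> G (last p) y"
proof (rule ccontr)
  assume "\<not> thesis"
  then have t: "nbrs t \<inter> (nbrs (hd p) \<union> nbrs (last p)) \<subseteq> set p"
    using that by (auto simp: nbrs_def)
  have "joined (set p) (hd p) (last p)" using assms(2) by (auto simp: joined_def)
  then have uv: "nbrs (hd p) \<inter> nbrs (last p) \<subseteq> set p" using joined_disjoint assms by blast
  have "card {t, hd p, last p} = 3" using assms(5,9,10) by simp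
  then have "3 * \<delta> + card (set p \<inter> Y) + 5 \<le> 3 * \<delta> + (\<Sum>u\<in>{t, hd p, last p}. card (nbrs u \<inter> set p))"
    using count[of "{t, hd p, last p}" "set p"] assms(3,4,7) t uv by auto
  also have "(\<Sum>u\<in>{t, hd p, last p}. card (nbrs u \<inter> set p)) \<le> 3 + card (set p \<inter> X)"
    using card_crossing[OF assms(2-4)] no_crossing[OF assms(1-4,6)] assms(5,8-10) by simp
  finally show False using path_card[OF assms(2-4)] by simp
qed

text \<open>The induction makes the ear shortest. Its \<open>X\<close>-vertex \<open>r\<close> then
  has at most three neighbours on a path through the ear and \<open>c\<close>, so it shares a
  neighbour \<open>y\<close> off that path with one of its ends; rerouting through \<open>y\<close>
  adds \<open>r\<close> to the cycle.\<close>

lemma no_ear: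
  assumes b: "b \<le> 1" and c: "cycle c" "card (set c \<inter> X) = k" and ear: "ear c R p q"
  shows False
  using ear
proof (induction "length R" arbitrary: R rule: less_induct)
  case less
  have e: "path R" "set R \<inter> set c = {}" "G p (hd R)" "G (last R) q"
    using less.prems by (auto simp: ear_def)
  obtain r where r: "r \<in> set R" "r \<in> X" using less.prems by (auto simp: ear_def)
  obtain R1 R2 where R: "R = R1 @ r # R2" using r(1) by (meson split_list)
  have rc: "r \<notin> set c" using r e by blast
  have P: "path (R1 @ r # R2)" using e(1) R by simp
  \<comment> \<open>A further neighbour of \<open>r\<close> on \<open>R\<close> would be a shortcut
    to a shorter ear that still contains \<open>r\<close>.\<close>
  have left: "y = last R1" if y: "y \<in> set R1" "G r y" for y
  proof (rule ccontr)
    assume "y \<noteq> last R1"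
    obtain L M where LM: "R1 = L @ y # M" using y(1) by (meson split_list)
    with \<open>y \<noteq> last R1\<close> have "M \<noteq> []" by auto
    let ?R = "L @ [y, r] @ R2"
    have "path ?R" using P LM sym[OF y(2)] by (auto simp: path_def successively_append_iff successively_Cons)
    moreover have "hd ?R = hd R" "last ?R = last R" "set ?R \<subseteq> set R" using R LM by (auto simp: hd_append)
    ultimately have "ear c ?R p q" using less.prems r(2) by (auto simp: ear_def)
    moreover have "length ?R < length R" using R LM \<open>M \<noteq> []\<close> by simp
    ultimately show False using less.hyps by blast
  qed
  have right: "y = hd R2" if y: "y \<in> set R2" "G r y" for y
  proof (rule ccontr)
    assume "y \<noteq> hd R2"
    obtain L M where LM: "R2 = L @ y # M" using y(1) by (meson split_list)
    with \<open>y \<noteq> hd R2\<close> have "L \<noteq> []" by auto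
    let ?R = "R1 @ [r, y] @ M"
    have "path ?R" using P LM y(2) by (auto simp: path_def successively_append_iff successively_Cons)
    moreover have "hd ?R = hd R" "last ?R = last R" "set ?R \<subseteq> set R" using R LM by (auto simp: hd_append)
    ultimately have "ear c ?R p q" using less.prems r(2) by (auto simp: ear_def)
    moreover have "length ?R < length R" using R LM \<open>L \<noteq> []\<close> by simp
    ultimately show False using less.hyps by blast
  qed
  have "nbrs r \<inter> set R \<subseteq> {last R1, hd R2}"
    using left right R nbrs_subset[OF r(2)] X_notin_Y[OF r(2)] by (auto simp: nbrs_def)
  then have "card (nbrs r \<inter> set R) \<le> card {last R1, hd R2}" by (intro card_mono) auto
  also have "\<dots> \<le> 2" by (simp add: card_insert_if)
  finally have dR: "card (nbrs r \<inter> set R) \<le> 2" .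
  have dc: "card (nbrs r \<inter> set c) \<le> 1" using missed[OF c r(2) rc] b by simp
  have longer: False if "cycle d" "insert r (set c \<inter> X) \<subseteq> set d" for d
  proof -
    have "insert r (set c \<inter> X) \<inter> X = insert r (set c \<inter> X)" using r by blast
    then show False using no_longer_cycle[OF that] c(2) rc by simp
  qed
  from c(1) less.prems show False
  proof (cases rule: ear_decomposition)
    case (absorbed d)
    then show False using longer[of d] r by blast
  next
    case (split A f B g)
    have f: "set f \<subseteq> Y" "set g \<subseteq> Y" using split by auto
    have cyc: "path A" "path (A @ f @ B)" "path (B @ g)" "G (last (B @ g)) (hd A)" "distinct (A @ f @ B @ g)"
      "set A \<inter> set (B @ g) = {}"
      using split(1,3,4) by (auto simp: cycle_def path_def successively_append_iff hd_append split: if_splits)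
    have cX: "set c \<inter> X \<subseteq> set A \<union> set B" using split(2) f X_notin_Y by auto
    have pB: "path B" using cyc(3) split(4) by (auto simp: path_def successively_append_iff)
    let ?P = "A @ rev R @ rev B"
    have Rne: "R \<noteq> []" using R by simp
    have dis: "set A \<inter> set R = {}" "set B \<inter> set R = {}" "set f \<inter> set R = {}" "set g \<inter> set R = {}"
      using split(2) e(2) by auto
    have PP: "path ?P" using cyc(1,6) pB e split(3-6) Rne dis sym[OF e(3)] sym[OF e(4)]
      by (auto simp: path_simps)
    have hl: "hd ?P = hd A" "last ?P = hd B" using split(3,4) by (simp_all add: last_rev)
    have hds: "hd A \<in> set A" "hd B \<in> set B" "hd B \<in> set (B @ g)" using split(3,4) by auto
    have ne: "hd A \<noteq> hd B" "r \<noteq> hd A" "r \<noteq> hd B"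
      using hds cyc(6) dis(1,2) r(1) by (metis disjoint_iff)+
    have "insert r (set c \<inter> X) \<subseteq> set ?P \<inter> X" using cX r by auto
    then have "card (insert r (set c \<inter> X)) \<le> card (set ?P \<inter> X)" by (intro card_mono) auto
    then have big: "k < card (set ?P \<inter> X)" using rc c(2) by simp
    have "nbrs r \<inter> set ?P \<subseteq> (nbrs r \<inter> set c) \<union> (nbrs r \<inter> set R)" using split(2) by auto
    then have "card (nbrs r \<inter> set ?P) \<le> card ((nbrs r \<inter> set c) \<union> (nbrs r \<inter> set R))"
      by (intro card_mono) auto
    also have "\<dots> \<le> 3" using card_Un_le[of "nbrs r \<inter> set c" "nbrs r \<inter> set R"] dR dc by simp
    finally have "card (nbrs r \<inter> set ?P) \<le> 3" .
    then obtain y where y: "y \<notin> set ?P" "G r y" "G (hd A) y \<or> G (hd B) y"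
      using shared_neighbour[OF b PP, unfolded hl, OF split(9,10) ne(1) big r(2) _ ne(2,3)] by blast
    have P1: "path (R1 @ [r])" "path (rev (r # R2))"
      using P unfolding path_rev by (auto simp: path_def successively_append_iff)
    have hl1: "hd (R1 @ [r]) = hd R" "last (R1 @ [r]) = r" "hd (rev (r # R2)) = last R" "last (rev (r # R2)) = r"
      using R by (auto simp: hd_append hd_rev)
    have sub: "set (R1 @ [r]) \<subseteq> set R" "set (rev (r # R2)) \<subseteq> set R" using R by auto
    \<comment> \<open>The cycle passes \<open>A\<close>, \<open>f\<close> and \<open>B\<close>,
      enters the ear at \<open>p\<close> and returns from \<open>r\<close> through \<open>y\<close>
      to \<open>hd A\<close>.\<close>
    have noA: False if "G (hd A) y" "y \<notin> set f"
    proof -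
      have "cycle ((A @ f @ B) @ (R1 @ [r]) @ [y])"
      proof (rule cycle_close)
        show "set (A @ f @ B) \<inter> set (R1 @ [r]) = {}" using sub dis by fastforce
        show "y \<notin> set (A @ f @ B)" "y \<notin> set (R1 @ [r])" using y(1) that(2) sub by auto
        show "G (last (A @ f @ B)) (hd (R1 @ [r]))" using e(3) hl1 split(4,6) by simp
        show "G y (hd (A @ f @ B))" using sym[OF that(1)] split(3) by simp
      qed (use cyc P1 y(2) in auto)
      then show False by (rule longer) (use cX in auto)
    qed
    have noB: False if "G (hd B) y" "y \<notin> set g"
    proof -
      have "cycle (((B @ g) @ A) @ rev (r # R2) @ [y])"
      proof (rule cycle_close)
        show "path ((B @ g) @ A)" using cyc(1,3,4,6) split(3,4) by (subst path_append) auto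
        show "set ((B @ g) @ A) \<inter> set (rev (r # R2)) = {}" using sub dis by fastforce
        show "y \<notin> set ((B @ g) @ A)" "y \<notin> set (rev (r # R2))" using y(1) that(2) sub by auto
        show "G (last ((B @ g) @ A)) (hd (rev (r # R2)))" using sym[OF e(4)] hl1(3) split(3,5) by simp
        show "G (last (rev (r # R2))) y" using y(2) hl1(4) by simp
        show "G y (hd ((B @ g) @ A))" using sym[OF that(1)] split(4) by simp
      qed (rule P1)
      then show False by (rule longer) (use cX in auto)
    qed
    show False
    proof (cases "G (hd A) y")
      case True
      then have "y \<in> set f" using noA by blast
      \<comment> \<open>As the vertex between \<open>A\<close> and \<open>B\<close>,
        \<open>y\<close> is adjacent to \<open>hd B\<close> as well, so the symmetric cycle is
        available.\<close>
      then have fy: "f = [y]" using split(7) by auto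
      then have "G (hd B) y" using cyc(2) sym[of y "hd B"] split(3,4)
        by (auto simp: path_def successively_append_iff successively_Cons)
      moreover have "y \<notin> set g" using fy cyc(5) by auto
      ultimately show False by (rule noB)
    next
      case False
      then have "G (hd B) y" using y(3) by blast
      then have "y \<in> set g" using noB by blast
      then have "g = [y]" using split(8) by auto
      then show False using sym[OF cyc(4)] False by simp
    qed
  qed
qed

text \<open>A vertex \<^term>\<open>x\<close> adjacent to every \<^term>\<open>Y\<close>-vertex of a longest cycle has a further neighbour; a path
  leaving through it and returning to the cycle can be closed up via \<^term>\<open>x\<close>.\<close>

lemma not_all_neighbours:
  assumes 2: "two_connected_graph G (X \<union> Y)" and c: "cycle c" "card (set c \<inter> X) = k"
    and x: "x \<in> X" "x \<notin> set c" and all: "set c \<inter> Y \<subseteq> nbrs x"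
  shows False
proof -
  let ?S = "X \<union> Y"
  have cS: "set c \<subseteq> ?S" using c(1) by (rule cycle_subset)
  have "card (nbrs x \<inter> set c) \<le> card (set c \<inter> Y)"
    using nbrs_subset[OF x(1)] by (intro card_mono) auto
  also have "\<dots> = k" using cycle_card[OF c(1)] c(2) by simp
  finally have "\<not> nbrs x \<subseteq> set c" using degree[OF x(1)] k_less by (auto simp: Int_absorb2)
  then obtain y where y: "G x y" "y \<notin> set c" by (auto simp: nbrs_def)
  have yY: "y \<in> Y" using adj_Y[OF y(1) x(1)] .
  have "connected_on G (?S - {x})" using 2 x(1) by (simp add: two_connected_graph_def)
  then obtain R t where R: "path R" "hd R = y" "set R \<subseteq> (?S - {x}) - set c" "t \<in> set c" "G (last R) t"
  proof (rule path_to_set)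
    show "y \<in> ?S - {x}" using yY x(1) X_notin_Y by blast
    show "set c \<subseteq> ?S - {x}" using cS x(2) by blast
    show "set c \<noteq> {}" using c(1) by (auto simp: cycle_def path_def)
  qed (use y in auto)
  have Rne: "R \<noteq> []" using R(1) by (simp add: path_def)
  then have lR: "last R \<in> set R" by simp
  obtain d where d: "cycle (d @ [t])" "set (d @ [t]) = set c" using cycle_rotate_to_last[OF c(1) R(4)] .
  have dne: "d \<noteq> []" using d(1) by (auto simp: cycle_def)
  have Gx: "G y x" using sym[OF y(1)] .
  have xR: "x \<notin> set R" using R(3) by blast
  have dR: "set (d @ [t]) \<inter> set R = {}" using R(3) unfolding d(2) by blast
  have xd: "x \<notin> set (d @ [t])" unfolding d(2) by (rule x(2))
  show False
  proof (cases "t \<in> X")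
    case True
    \<comment> \<open>From \<open>t\<close> go through \<open>R\<close> to \<open>y\<close>, then
      through \<open>x\<close> to the successor of \<open>t\<close>, which is in
      \<open>Y\<close>.\<close>
    have hd: "hd (d @ [t]) \<in> Y" using d(1) True adj_Y by (auto simp: cycle_def)
    then have "G x (hd (d @ [t]))" using all d(2) dne
      by (metis IntI append_is_Nil_conv hd_in_set mem_Collect_eq nbrs_def subsetD)
    then have "cycle ((d @ [t]) @ rev R @ [x])"
      using d(1) R(1,2) Gx xR dR xd dne Rne sym[OF R(5)]
      by (auto simp: cycle_def path_def successively_append_iff successively_Cons hd_rev last_rev hd_append Suc_le_eq)
    moreover have "insert x (set c \<inter> X) \<subseteq> set ((d @ [t]) @ rev R @ [x])" using d(2) by auto
    moreover have "insert x (set c \<inter> X) \<inter> X = insert x (set c \<inter> X)" using x by blast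
    ultimately show False using no_longer_cycle x c(2) by (metis card_insert_disjoint finite_Int finite_set IntD1 lessI)
  next
    case False
    then have tY: "t \<in> Y" using R(4) cS by blast
    \<comment> \<open>The successor \<open>u\<close> of \<open>t\<close> is in \<open>X\<close>, so
      it cannot follow \<open>x\<close> and is dropped; \<open>last R\<close>, also in
      \<open>X\<close>, makes up for it.\<close>
    obtain u d' where d': "d = u # d'" using dne by (cases d) auto
    have uX: "u \<in> X" using d(1) d' adj_X[OF _ tY] by (auto simp: cycle_def)
    have lX: "last R \<in> X" using sym[OF R(5)] adj_X tY by blast
    have P: "path (d' @ [t])" "G u (hd (d' @ [t]))" "u \<notin> set (d' @ [t])"
      using d(1) d' by (auto simp: cycle_def path_def successively_Cons)
    have "hd (d' @ [t]) \<in> set c \<inter> Y" using adj_Y[OF P(2) uX] d(2) d' by (cases d') auto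
    then have "G x (hd (d' @ [t]))" using all by (auto simp: nbrs_def)
    moreover have "path ((d' @ [t]) @ rev R @ [x])" using P(1) R(1,2) Gx xR dR xd Rne d' sym[OF R(5)]
      by (auto simp: path_def successively_append_iff successively_Cons hd_rev last_rev)
    ultimately have "cycle ((d' @ [t]) @ rev R @ [x])"
      using Rne by (auto simp: cycle_def hd_append Suc_le_eq)
    moreover let ?A = "insert x (insert (last R) (set c \<inter> X - {u}))"
    have "?A \<subseteq> set ((d' @ [t]) @ rev R @ [x])" using d(2) d' lR by auto
    moreover have "?A \<inter> X = ?A" using x lX by auto
    moreover have "card ?A = Suc k"
    proof -
      have "u \<in> set c \<inter> X" using d(2) d' uX by auto
      then have "card (set c \<inter> X - {u}) = k - 1" using c(2) by simp
      moreover have "last R \<notin> set c" "last R \<noteq> x" using lR R(3) by auto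
      ultimately show ?thesis using x(2) k_ge by simp
    qed
    ultimately show False using no_longer_cycle by (metis lessI)
  qed
qed

text \<open>Otherwise a path from \<open>u\<close> to \<open>v\<close> has at least two crossings.
  The crossings together with \<open>u\<close> and \<open>v\<close> are pairwise joined on
  \<open>Q\<close>, and each crossing has degree at most \<open>b\<close> into \<open>Q\<close>,
  which contradicts \<open>count\<close>.\<close>

lemma end_degrees:
  assumes "2 * b \<le> k + 2" "joined Q u v" "u \<in> X" "v \<in> X" "u \<noteq> v" "card (Q \<inter> X) = Suc k"
  shows "card (nbrs u \<inter> Q) + card (nbrs v \<inter> Q) \<le> k + 2"
proof (rule ccontr)
  assume big: "\<not> ?thesis"
  obtain p where p: "path p" "set p = Q" "hd p = u" "last p = v"
    using assms(2) by (auto simp: joined_def)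
  have e: "hd p \<in> X" "last p \<in> X" using p assms by auto
  let ?Z = "crossing p"
  define s where "s = card ?Z"
  have Z: "?Z \<subseteq> Q \<inter> X"
    using prevs_subset[OF p(1) nbrs_subset[OF e(1)]] p(2) unfolding crossing_def by blast
  then have finZ: "finite ?Z" using finX finite_subset by blast
  have ends: "card (nbrs u \<inter> Q) + card (nbrs v \<inter> Q) \<le> Suc k + s"
    using card_crossing[OF p(1) e] assms(6) p by (simp add: s_def)
  then have s2: "2 \<le> s" using big by simp
  have finQ: "finite Q" using p(2) by auto
  have hdZ: "u \<notin> ?Z" "v \<notin> ?Z"
    using crossing_ends[OF p(1) _ e] p by auto
  have uv: "nbrs u \<inter> nbrs v \<subseteq> Q" using joined_disjoint assms by simp
  have zu: "nbrs z \<inter> nbrs u \<subseteq> Q" "nbrs z \<inter> nbrs v \<subseteq> Q" if "z \<in> ?Z" for z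
    using joined_disjoint[of Q u z] joined_disjoint[of Q z v] crossing_joined[OF p(1) that e] p assms hdZ that Z
    by auto
  have zz: "nbrs z \<inter> nbrs z' \<subseteq> Q" if "z \<in> ?Z" "z' \<in> ?Z" "z \<noteq> z'" for z z'
    using joined_disjoint[of Q z z'] crossing_pair_joined[OF p(1) that(1,2) e that(3)] p assms that Z by auto
  let ?D = "insert u (insert v ?Z)"
  have "card ?D = s + 2" using hdZ assms(5) finZ by (simp add: s_def)
  moreover have "card ?D * \<delta> + card (Q \<inter> Y) + 5 \<le> 3 * \<delta> + (\<Sum>t\<in>?D. card (nbrs t \<inter> Q))"
  proof (rule count)
    show "?D \<subseteq> X" using Z assms by auto
    show "nbrs t \<inter> nbrs t' \<subseteq> Q" if "t \<in> ?D" "t' \<in> ?D" "t \<noteq> t'" for t t'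
      using that uv zu zz by (elim insertE) blast+
  qed (rule finQ)
  moreover have "(\<Sum>t\<in>?D. card (nbrs t \<inter> Q)) = card (nbrs u \<inter> Q) + card (nbrs v \<inter> Q) + (\<Sum>t\<in>?Z. card (nbrs t \<inter> Q))"
    using hdZ assms(5) finZ by simp
  moreover have "(\<Sum>t\<in>?Z. card (nbrs t \<inter> Q)) \<le> (\<Sum>t\<in>?Z. b)"
  proof (rule sum_mono)
    fix z assume z: "z \<in> ?Z"
    obtain c where "cycle c" "set c = set p - {z}" using crossing_cycle[OF p(1) z e] .
    then show "card (nbrs z \<inter> Q) \<le> b" using removable_degree[of c Q z] z Z p assms(6) by auto
  qed
  moreover have "card (Q \<inter> Y) = k" using path_card[OF p(1) e] assms(6) p(2) by simp
  ultimately have "(s + 2) * \<delta> + k + 5 \<le> 3 * \<delta> + Suc k + s + s * b" using ends by (simp add: s_def)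
  then have "int s * (int \<delta> - int b - 1) \<le> int \<delta> - 4"
    by (simp add: algebra_simps flip: of_nat_mult of_nat_add) 
  \<comment> \<open>With at least two crossings, \<open>\<delta> + 2 \<le> 2 * b\<close> follows,
    against \<open>2 * b \<le> k + 2\<close> and \<open>k < \<delta>\<close>.\<close>
  moreover have "2 * (int \<delta> - int b - 1) \<le> int s * (int \<delta> - int b - 1)"
    using s2 assms(1) k_less k_ge by (intro mult_right_mono) auto
  ultimately show False using assms(1) k_less by simp
qed

text \<open>Used when \<^term>\<open>last c\<close> is adjacent to \<^term>\<open>x\<close>: then \<open>hubs c x\<close> consists of \<^term>\<open>x\<close> and the cyclic successors on
  \<^term>\<open>c\<close> of the neighbours of \<^term>\<open>x\<close>. The successor of \<^term>\<open>last c\<close> on the cycle is \<^term>\<open>hd c\<close>, while its successor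
  on the path \<^term>\<open>c @ [x]\<close> is \<^term>\<open>x\<close> itself.\<close>

definition hubs :: "'a list \<Rightarrow> 'a \<Rightarrow> 'a set" where
  "hubs c x = insert (hd c) (nexts (c @ [x]) (nbrs x))"

section \<open>Paths through a longest cycle and a missed vertex\<close>

context
  fixes c :: "'a list" and x :: 'a
  assumes c: "cycle c" "card (set c \<inter> X) = k" and x: "x \<in> X" "x \<notin> set c" and closed: "G (last c) x"
begin

lemma extended_path: "path (c @ [x])"
  using c(1) x closed by (auto simp: cycle_def path_def successively_append_iff)

lemma c_ne: "c \<noteq> []" and hd_c: "hd c \<in> X"
  using c(1) adj_X[of "last c" "hd c"] adj_Y[OF sym[OF closed] x(1)] by (auto simp: cycle_def path_def)

lemma extended_X: "card (set (c @ [x]) \<inter> X) = Suc k"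
  using c(2) x by simp

lemma extended_Y: "card (set (c @ [x]) \<inter> Y) = k"
  using path_card[OF extended_path] hd_c c_ne x extended_X by simp

lemma nbrs_x: "nbrs x \<inter> set (c @ [x]) = nbrs x \<inter> set c"
  using nbrs_subset[OF x(1)] X_notin_Y[OF x(1)] by auto

lemma nexts_split:
  assumes "z \<in> nexts (c @ [x]) M" "c @ [x] = L @ z # R"
  shows "L \<noteq> []" "last L \<in> M"
proof -
  obtain A y B where p: "c @ [x] = A @ [y, z] @ B" "y \<in> M" using assms(1) by (auto simp: nexts_def)
  have d: "distinct (A @ [y, z] @ B)" "distinct (L @ z # R)"
    using extended_path p(1) assms(2) unfolding path_def by metis+
  then have "z \<notin> set (A @ [y])" "z \<notin> set B" by auto
  moreover have "(A @ [y]) @ z # B = L @ z # R" using p(1) assms(2) by simp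
  ultimately have "L = A @ [y]"
    using append_Cons_eq_iff[of z "A @ [y]" B L R] by blast
  then show "L \<noteq> []" "last L \<in> M" using p(2) by auto
qed

lemma hubs_subset: "hubs c x \<subseteq> set (c @ [x]) \<inter> X"
  using nexts_subset[OF extended_path nbrs_subset[OF x(1)]] hd_c c_ne by (auto simp: hubs_def)

lemma hd_notin_nexts: "hd c \<notin> nexts (c @ [x]) M"
proof
  assume "hd c \<in> nexts (c @ [x]) M"
  moreover have "c @ [x] = [] @ hd c # (tl c @ [x])" using c_ne by simp
  ultimately show False using nexts_split(1) by blast
qed

lemma card_hubs: "card (hubs c x) = Suc (card (nbrs x \<inter> set c))"
proof -
  have "finite (nexts (c @ [x]) (nbrs x))"
    using hubs_subset finite_subset unfolding hubs_def by fastforce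
  moreover have "card (nexts (c @ [x]) (nbrs x)) = card (nbrs x \<inter> set c)"
    using card_nexts[OF extended_path, of "nbrs x"] nbrs_x nbrs_subset[OF x(1)] X_notin_Y[OF x(1)] by auto
  ultimately show ?thesis using hd_notin_nexts by (simp add: hubs_def)
qed

lemma x_in_hubs: "x \<in> hubs c x"
proof -
  have "c @ [x] = butlast c @ [last c, x] @ []" using c_ne by simp
  then show ?thesis using sym[OF closed] unfolding hubs_def nexts_def nbrs_def by blast
qed

text \<open>A rotation in the sense of Posa: jump from the predecessor of \<open>z\<close> to the
  end \<open>x\<close> and walk back to \<open>z\<close>.\<close>

lemma hd_next_joined:
  assumes "z \<in> nexts (c @ [x]) (nbrs x)" shows "joined (set (c @ [x])) (hd c) z"
proof -
  obtain A y B where p: "c @ [x] = A @ [y, z] @ B" "G x y" using assms(1) by (auto simp: nexts_def nbrs_def)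
  have P: "path ((A @ [y]) @ z # B)" using extended_path p(1) by simp
  have lx: "last (z # B) = x" using arg_cong[OF p(1), of last] by simp
  have hx: "hd (A @ [y]) = hd c" using arg_cong[OF p(1), of hd] c_ne by (simp add: hd_append split: if_splits)
  have Gyx: "G y x" using sym[OF p(2)] .
  have "path ((A @ [y]) @ rev (z # B))"
    using path_append[THEN iffD1, OF _ _ P] lx Gyx
    by (subst path_append) (simp_all add: path_rev hd_rev del: rev.simps)
  then show ?thesis by (rule joinedI) (use p(1) hx in \<open>auto simp: hd_append\<close>)
qed

lemma next_next_joined_ordered:
  assumes "z \<in> nexts (c @ [x]) (nbrs x)" "z' \<in> nexts (c @ [x]) (nbrs x)" "c @ [x] = L @ z # M @ z' # R"
  shows "joined (set (c @ [x])) z z'"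
proof -
  have L: "L \<noteq> []" "G x (last L)" using nexts_split[OF assms(1,3)] by (auto simp: nbrs_def)
  have "c @ [x] = (L @ z # M) @ z' # R" using assms(3) by simp
  then have M': "last (z # M) \<in> nbrs x" using nexts_split(2)[OF assms(2)] by fastforce
  have "z \<in> X" using assms(1) hubs_subset by (auto simp: hubs_def)
  then have "z \<notin> nbrs x" using nbrs_subset[OF x(1)] X_notin_Y by blast
  with M' have M: "M \<noteq> []" "G x (last M)" by (auto simp: nbrs_def split: if_splits)
  have P: "path (L @ z # M @ z' # R)" using extended_path assms(3) by metis
  have hL: "hd L = hd c" using arg_cong[OF assms(3), of hd] c_ne L(1) by (simp add: hd_append)
  note G' = L(2)[THEN sym] M(2)[THEN sym] L(2)
  have GG: "G (hd c) (last c)" using c(1) sym[of "last c" "hd c"] by (simp add: cycle_def)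
  have setL: "set (c @ [x]) = set (L @ z # M @ z' # R)" using assms(3) by metis
  show ?thesis
  proof (cases "R = []")
    case True
    \<comment> \<open>Here \<open>M\<close> ends at \<open>last c\<close>, from which the closing
      edge leads to \<open>hd c\<close>, and \<open>L\<close> ends at a neighbour of
      \<open>x\<close>.\<close>
    then have cc: "c = L @ z # M" "z' = x" using assms(3) by auto
    then have "last c = last M" using M by simp
    then have "path ([z] @ M @ L @ [x])" using P True G' GG L(1) M(1) hL sym[of "hd c" "last M"]  cc(2)
      by (auto simp: path_def successively_append_iff successively_Cons)
    then show ?thesis by (rule joinedI) (use cc in auto)
  next
    case False
    \<comment> \<open>Go from \<open>z\<close> along \<open>M\<close> to \<open>x\<close>, back
      along \<open>L\<close> to \<open>hd c\<close>, by the closing edge to \<open>last c\<close>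
      and back to \<open>z'\<close>.\<close>
    then obtain R' where R: "R = R' @ [x]" using assms(3) by (metis append_butlast_last_id last.simps last_append last_snoc list.distinct(1) append_is_Nil_conv)
    then have cc: "c = L @ z # M @ z' # R'" using assms(3) by simp
    define T where "T = z' # R'"
    have T: "T \<noteq> []" "hd T = z'" "last T = last c" "c = L @ z # M @ T" using cc by (auto simp: T_def)
    have P': "path (L @ [z] @ M @ T @ [x])" using P R by (simp add: T_def)
    have "path ([z] @ M @ [x] @ rev L @ rev T)"
      using P' G' GG L(1) M(1) hL T(1,3)
      by (auto simp: path_def successively_append_iff successively_Cons hd_rev last_rev)
    then show ?thesis by (rule joinedI) (use T in \<open>auto simp: last_rev\<close>)
  qed
qed

lemma hubs_joined:
  assumes "u \<in> hubs c x" "v \<in> hubs c x" "u \<noteq> v"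
  shows "joined (set (c @ [x])) u v"
proof -
  have nn: "joined (set (c @ [x])) z z'"
    if z: "z \<in> nexts (c @ [x]) (nbrs x)" "z' \<in> nexts (c @ [x]) (nbrs x)" "z \<noteq> z'" for z z'
  proof -
    have in_p: "z \<in> set (c @ [x])" "z' \<in> set (c @ [x])" using z hubs_subset by (auto simp: hubs_def)
    then obtain L R where p: "c @ [x] = L @ z # R" by (meson split_list)
    have "z' \<in> set (L @ z # R)" using in_p(2) p by metis
    then have "z' \<in> set L \<or> z' \<in> set R" using z(3) by auto
    then show ?thesis
    proof
      assume "z' \<in> set R"
      then obtain M R' where "R = M @ z' # R'" by (meson split_list)
      then show ?thesis using next_next_joined_ordered[OF z(1,2)] p by simp
    next
      assume "z' \<in> set L"
      then obtain L' M where "L = L' @ z' # M" by (meson split_list)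
      then have "c @ [x] = L' @ z' # M @ z # R" using p by simp
      then show ?thesis using next_next_joined_ordered[OF z(2,1)] joined_sym by metis
    qed
  qed
  show ?thesis using assms nn hd_next_joined joined_sym unfolding hubs_def by blast
qed

lemma hubs_disjoint:
  assumes "u \<in> hubs c x" "v \<in> hubs c x" "u \<noteq> v"
  shows "nbrs u \<inter> nbrs v \<subseteq> set (c @ [x])"
  using joined_disjoint[OF hubs_joined[OF assms]] hubs_subset assms extended_X by auto

text \<open>Both cyclic neighbours of \<open>z\<close> on \<open>c\<close> are adjacent to
  \<open>x\<close>, so \<open>x\<close> can take the place of \<open>z\<close>.\<close>

lemma removable_hub:
  assumes "z \<in> hubs c x" "z \<in> prevs (c @ [x]) (nbrs x)"
  shows "card (nbrs z \<inter> set (c @ [x])) \<le> b"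
proof -
  have z: "z \<in> set (c @ [x])" "z \<in> X" using assms(1) hubs_subset by auto
  have "\<exists>d. cycle d \<and> set d = set (c @ [x]) - {z}"
  proof (cases "z = hd c")
    case True
    \<comment> \<open>The path without its first vertex is closed by the edge from \<open>x\<close>
      to \<open>y\<close>.\<close>
    obtain A y B where p: "c @ [x] = A @ [z, y] @ B" "G x y"
      using assms(2) by (auto simp: prevs_def nbrs_def)
    have d: "distinct (A @ [z, y] @ B)" using extended_path p unfolding path_def by metis
    have "A = []"
    proof (rule ccontr)
      assume "A \<noteq> []"
      then have "hd A = z" using arg_cong[OF p(1), of hd] c_ne True by simp
      then show False using d \<open>A \<noteq> []\<close> hd_in_set[of A] by auto
    qed
    then have p': "c @ [x] = z # y # B" using p by simp
    then have P: "path (z # y # B)" using extended_path by metis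
    have "last (y # B) = x" using arg_cong[OF p', of last] by simp
    moreover have "3 \<le> length (y # B)" using c(1) arg_cong[OF p', of length] by (simp add: cycle_def)
    ultimately have "cycle (y # B)" using P p(2) by (auto simp: cycle_def path_def)
    moreover have "set (y # B) = set (c @ [x]) - {z}" using P unfolding p' by (auto simp: path_def)
    ultimately show ?thesis by blast
  next
    case False
    then have "z \<in> nexts (c @ [x]) (nbrs x)" using assms(1) by (simp add: hubs_def)
    then obtain A w w' B where p0: "c @ [x] = A @ [w, z, w'] @ B" "w \<in> nbrs x" "w' \<in> nbrs x"
      by (rule nexts_prevs[OF extended_path _ assms(2)])
    then have p: "c @ [x] = A @ [w, z, w'] @ B" "G x w" "G x w'" by (auto simp: nbrs_def)
    have "B \<noteq> []"
    proof
      assume "B = []"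
      then have "w' = x" using arg_cong[OF p(1), of last] by simp
      then show False using bip[OF p(3)] disj by blast
    qed
    moreover from this have "last B = x" using arg_cong[OF p(1), of last] by simp
    ultimately obtain B' where B: "B = B' @ [x]" by (metis append_butlast_last_id)
    then have cc: "c = A @ [w, z, w'] @ B'" using p(1) by simp
    have "A \<noteq> []"
    proof
      assume "A = []"
      then have "hd c = w" using cc by simp
      then show False using hd_c adj_Y[OF p(2) x(1)] X_notin_Y by blast
    qed
    then have "cycle (A @ [w, x, w'] @ B')" using c(1) x(2) p(2,3) sym[OF p(2)] unfolding cc
      by (auto simp: cycle_def path_def successively_append_iff successively_Cons)
    moreover have "distinct (A @ [w, z, w'] @ B' @ [x])" using extended_path cc by (simp add: path_def)
    then have "set (A @ [w, x, w'] @ B') = set (c @ [x]) - {z}" unfolding cc by auto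
    ultimately show ?thesis by blast
  qed
  then show ?thesis using removable_degree z extended_X by metis
qed

end

text \<open>This settles \<open>2 \<le> b < k\<close>. All \<open>b + 1\<close> hubs are available
  for \<open>count\<close>; three or four suffice for small \<open>b\<close>, all are used for large
  \<open>b\<close>.\<close>

lemma few_nbrs_on_path:
  assumes c: "cycle c" "card (set c \<inter> X) = k" and x: "x \<in> X" "x \<notin> set c" and closed: "G (last c) x"
    and b: "card (nbrs x \<inter> set c) = b" "2 \<le> b" "b < k"
  shows False
proof -
  note facts = c x closed
  let ?Q = "set (c @ [x])" and ?D = "hubs c x"
  have DX: "?D \<subseteq> ?Q \<inter> X" using hubs_subset[OF facts] .
  then have finD: "finite ?D" using finite_subset by blast
  have cD: "card ?D = Suc b" using card_hubs[OF facts] b by simp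
  have dx: "card (nbrs x \<inter> ?Q) = b" using nbrs_x[OF facts] b by simp
  have cnt: "card D' * \<delta> + k + 5 \<le> 3 * \<delta> + (\<Sum>u\<in>D'. card (nbrs u \<inter> ?Q))" if "D' \<subseteq> ?D" for D'
    using count[of D' ?Q] that DX hubs_disjoint[OF facts] extended_Y[OF facts] by (metis (no_types, lifting) finite_set in_mono inf.boundedE subset_trans)
  show False
  proof (cases "2 * b \<le> k + 2")
    case True
    have pair: "card (nbrs u \<inter> ?Q) + card (nbrs v \<inter> ?Q) \<le> k + 2"
      if "u \<in> ?D" "v \<in> ?D" "u \<noteq> v" for u v
      using end_degrees[OF True hubs_joined[OF facts that] _ _ that(3) extended_X[OF facts]] that DX by blast
    have "card (?D - {x}) = b" using cD x_in_hubs[OF facts] by simp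
    then obtain D' where "D' \<subseteq> ?D - {x}" "card D' = 2" using b(2) by (metis obtain_subset_with_card_n)
    then obtain u v where uv: "u \<in> ?D" "v \<in> ?D" "u \<noteq> v" "u \<noteq> x" "v \<noteq> x" by (auto simp: card_2_iff)
    show False
    proof (cases "b = 2")
      case True
      \<comment> \<open>\<open>pair\<close> and the degree 2 of \<open>x\<close> bound the sum by
        \<open>k + 4\<close>, where \<open>k + 5\<close> is required.\<close>
      show False using cnt[of "{x, u, v}"] uv x_in_hubs[OF facts] pair[OF uv(1-3)] dx True by simp
    next
      case False
      have "card (?D - {x, u, v}) = Suc b - 3"
        using cD uv x_in_hubs[OF facts] by (subst card_Diff_subset) auto
      then have "card (?D - {x, u, v}) \<noteq> 0" using b(2) False by simp
      then obtain w where w: "w \<in> ?D" "w \<noteq> x" "w \<noteq> u" "w \<noteq> v" by (metis DiffE all_not_in_conv card.empty insertCI)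
      \<comment> \<open>Adding the three instances of \<open>pair\<close> bounds the degrees of
        \<open>u\<close>, \<open>v\<close>, \<open>w\<close> by half of \<open>3 * (k + 2)\<close>;
        with \<open>b\<close> for \<open>x\<close> this is too little once a fourth vertex
        contributes \<open>\<delta>\<close>.\<close>
      show False using cnt[of "{x, u, v, w}"] uv w x_in_hubs[OF facts] pair[OF uv(1-3)]
          pair[OF uv(1) w(1)] pair[OF uv(2) w(1)] dx True k_less by simp
    qed
  next
    case False
    \<comment> \<open>The hubs in \<open>H\<close> have degree at most \<open>b\<close> into the
      path: \<open>x\<close> and those lying between two neighbours of \<open>x\<close>.
      Inclusion-exclusion gives at least \<open>2 * b + 1 - k\<close> of them.\<close>
    define H where "H = insert x (?D \<inter> prevs (c @ [x]) (nbrs x))"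
    let ?P = "prevs (c @ [x]) (nbrs x)"
    have PX: "?P \<subseteq> ?Q \<inter> X"
      using prevs_subset[OF extended_path[OF facts] nbrs_subset[OF x(1)]] .
    then have finP: "finite ?P" using finite_subset by blast
    have hdX: "hd (c @ [x]) \<in> X" using hd_c[OF facts] c_ne[OF facts] by simp
    have "card ?P = b"
      using card_prevs[OF extended_path[OF facts], of "nbrs x"] nbrs_subset[OF x(1)] X_notin_Y[OF hdX] dx by auto
    moreover have "card (?D \<union> ?P) \<le> card (?Q \<inter> X)" using DX PX by (intro card_mono) auto
    ultimately have "2 * b + 1 \<le> Suc k + card (?D \<inter> ?P)"
      using card_Un_Int[OF finD finP] cD extended_X[OF facts] by simp
    moreover have "x \<notin> ?P"
    proof
      assume "x \<in> ?P"
      then obtain A y B where p: "c @ [x] = A @ [x, y] @ B" by (auto simp: prevs_def)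
      have "last (y # B) = x" using arg_cong[OF p, of last] by simp
      then have "x \<in> set (y # B)" by (metis last_in_set list.distinct(1))
      moreover have "distinct (A @ [x, y] @ B)" using extended_path[OF facts] p unfolding path_def by metis
      ultimately show False by auto
    qed
    ultimately have cH: "2 * b + 1 \<le> k + card H" using finD by (simp add: H_def)
    have HD: "H \<subseteq> ?D" using x_in_hubs[OF facts] by (auto simp: H_def)
    then have cHD: "card H \<le> Suc b" using cD card_mono[OF finD] by metis
    have 1: "(\<Sum>u\<in>H. card (nbrs u \<inter> ?Q)) \<le> (\<Sum>u\<in>H. b)"
      using removable_hub[OF facts] dx by (intro sum_mono) (auto simp: H_def)
    have 2: "(\<Sum>u\<in>?D - H. card (nbrs u \<inter> ?Q)) \<le> (\<Sum>u\<in>?D - H. k)"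
    proof (rule sum_mono)
      fix u assume "u \<in> ?D - H"
      then have "u \<in> X" using DX by blast
      then have "card (nbrs u \<inter> ?Q) \<le> card (?Q \<inter> Y)" using nbrs_subset by (intro card_mono) auto
      then show "card (nbrs u \<inter> ?Q) \<le> k" using extended_Y[OF facts] by simp
    qed
    have "(\<Sum>u\<in>?D. card (nbrs u \<inter> ?Q)) \<le> card H * b + (Suc b - card H) * k"
      using sum.subset_diff[OF HD finD, of "\<lambda>u. card (nbrs u \<inter> ?Q)"] 1 2 cD card_Diff_subset[OF _ HD] finite_subset[OF HD finD] by simp
    then have main: "Suc b * \<delta> + k + 5 \<le> 3 * \<delta> + (card H * b + (Suc b - card H) * k)"
      using cnt[of ?D] cD by simp
    \<comment> \<open>\<open>h\<close> will be the excess of \<open>card H\<close> over its lower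
      bound \<open>b + 1 - \<kappa>\<close>, so \<open>\<kappa> - h\<close> hubs lie outside
      \<open>H\<close>; only \<open>k\<close> bounds their degrees.\<close>
    define \<kappa> where "\<kappa> = k - b"
    have \<kappa>: "k = b + \<kappa>" "1 \<le> \<kappa>" using b(3) by (simp_all add: \<kappa>_def)
    define h where "h = card H + \<kappa> - (b + 1)"
    have h: "card H + \<kappa> = b + 1 + h" using cH \<kappa>(1) by (simp add: h_def)
    have hk: "h \<le> \<kappa>" using h cHD by simp
    have "int (Suc b) * int \<delta> + int k + 5 \<le> 3 * int \<delta> + (int (card H) * int b + (int (Suc b) - int (card H)) * int k)"
      using main[unfolded of_nat_le_iff[where 'a = int, symmetric]]
      by (simp only: of_nat_add of_nat_mult of_nat_diff[OF cHD] of_nat_numeral)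
    moreover have "int (card H) = int b + 1 + int h - int \<kappa>" using h by simp
    ultimately have "(int b - 2) * int \<delta> + int k + 5
        \<le> (int b + 1 + int h - int \<kappa>) * int b + (int \<kappa> - int h) * (int b + int \<kappa>)"
      using \<kappa>(1) by (simp add: algebra_simps)
    moreover have "(int b - 2) * (int k + 1) \<le> (int b - 2) * int \<delta>"
      using k_less b(2) by (intro mult_left_mono) auto
    \<comment> \<open>Both factors are nonnegative by \<open>b < k\<close> and
      \<open>k + 2 < 2 * b\<close>; adding their product leaves only
      \<open>1 + \<kappa> * h \<le> 0\<close>.\<close>
    moreover have "0 \<le> (int \<kappa> - 1) * (int b - 2 - int \<kappa>)"
      using False \<kappa> by (intro mult_nonneg_nonneg) auto
    ultimately have "1 + int \<kappa> * int h \<le> 0" using \<kappa>(1) by (simp add: algebra_simps)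
    moreover have "0 \<le> int \<kappa> * int h" by simp
    ultimately show False by linarith
  qed
qed

end

section \<open>Existence of a cycle through all of \<open>X\<close>\<close>

context bigraph
begin

text \<open>Among three vertices of \<open>X\<close> two share two neighbours, hence lie on a
  4-cycle: otherwise the three neighbourhoods would cover at least \<open>3 * \<delta> - 3\<close>
  elements of \<open>Y\<close>. This provides \<open>2 \<le> k\<close>.\<close>

lemma short_cycle:
  fixes \<delta> :: nat
  assumes "3 \<le> card X" "card Y + 5 \<le> 3 * \<delta>" and deg: "\<And>x. x \<in> X \<Longrightarrow> \<delta> \<le> card (nbrs x)"
  obtains c where "cycle c" "2 \<le> card (set c \<inter> X)"
proof -
  obtain T where "T \<subseteq> X" "card T = 3" using obtain_subset_with_card_n[OF assms(1)] by metis
  then obtain u v w where uvw: "u \<in> X" "v \<in> X" "w \<in> X" "u \<noteq> v" "u \<noteq> w" "v \<noteq> w"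
    by (auto simp: card_3_iff)
  have "\<exists>a b. a \<in> X \<and> b \<in> X \<and> a \<noteq> b \<and> 2 \<le> card (nbrs a \<inter> nbrs b)"
  proof (rule ccontr)
    assume "\<not> ?thesis"
    then have le: "card (nbrs u \<inter> nbrs v) \<le> 1" "card (nbrs u \<inter> nbrs w) \<le> 1" "card (nbrs v \<inter> nbrs w) \<le> 1"
      using uvw by (metis not_less_eq_eq numeral_2_eq_2 One_nat_def)+
    have fin: "finite (nbrs u)" "finite (nbrs v)" "finite (nbrs w)" using uvw finite_nbrs by auto
    have "(nbrs u \<union> nbrs v) \<inter> nbrs w = (nbrs u \<inter> nbrs w) \<union> (nbrs v \<inter> nbrs w)" by blast
    then have "card ((nbrs u \<union> nbrs v) \<inter> nbrs w) \<le> 2"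
      using card_Un_le[of "nbrs u \<inter> nbrs w" "nbrs v \<inter> nbrs w"] le by simp
    then have "card (nbrs u) + card (nbrs v) + card (nbrs w) \<le> card (nbrs u \<union> nbrs v \<union> nbrs w) + 3"
      using card_Un_Int[OF fin(1,2)] card_Un_Int[OF _ fin(3), of "nbrs u \<union> nbrs v"] fin le by simp
    also have "card (nbrs u \<union> nbrs v \<union> nbrs w) \<le> card Y"
      using uvw nbrs_subset finY by (intro card_mono) blast+
    finally show False using assms(2) deg[OF uvw(1)] deg[OF uvw(2)] deg[OF uvw(3)] by simp
  qed
  then obtain a b where ab: "a \<in> X" "b \<in> X" "a \<noteq> b" "2 \<le> card (nbrs a \<inter> nbrs b)" by blast
  obtain S where "S \<subseteq> nbrs a \<inter> nbrs b" "card S = 2" using obtain_subset_with_card_n[OF ab(4)] by metis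
  then obtain y y' where y: "G a y" "G b y" "G a y'" "G b y'" "y \<noteq> y'"
    by (auto simp: card_2_iff nbrs_def)
  have "y \<in> Y" "y' \<in> Y" using y ab adj_Y by auto
  then have "cycle [a, y, b, y']"
    using y ab X_notin_Y sym[OF y(2)] sym[OF y(3)] by (auto simp: cycle_def path_def)
  moreover have "card {a, b} \<le> card (set [a, y, b, y'] \<inter> X)" using ab by (intro card_mono) auto
  ultimately show thesis using that ab(3) by simp
qed

lemma spanning_cycle:
  fixes \<delta> :: nat
  assumes 2: "two_connected_graph G (X \<union> Y)"
    and card: "3 \<le> card X" "card X \<le> \<delta>" "card Y + 5 \<le> 3 * \<delta>"
    and deg: "\<And>x. x \<in> X \<Longrightarrow> \<delta> \<le> card (nbrs x)"
  obtains c where "cycle c" "X \<subseteq> set c"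
proof (rule ccontr)
  assume "\<not> thesis"
  then have no: "\<And>c. cycle c \<Longrightarrow> \<not> X \<subseteq> set c" using that by blast
  let ?M = "(\<lambda>c. card (set c \<inter> X)) ` {c. cycle c}"
  define k where "k = Max ?M"
  have bound: "card (set c \<inter> S) \<le> card S" if "finite S" for c S using that by (intro card_mono) auto
  have finM: "finite ?M" using bound[OF finX] by (intro finite_subset[of ?M "{..card X}"]) auto
  obtain c0 where c0: "cycle c0" "2 \<le> card (set c0 \<inter> X)" using short_cycle[OF card(1,3) deg] by blast
  have kmax: "card (set c \<inter> X) \<le> k" if "cycle c" for c
    unfolding k_def using finM that by (intro Max_ge) auto
  have "k \<in> ?M" unfolding k_def using finM c0(1) by (intro Max_in) auto
  then obtain c1 where c1: "cycle c1" "card (set c1 \<inter> X) = k" by auto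
  have "set c1 \<inter> X \<subset> X" using no[OF c1(1)] by blast
  then have kX: "k < card X" using c1(2) finX psubset_card_mono by blast
  let ?B = "{card (nbrs x \<inter> set c) | c x. cycle c \<and> card (set c \<inter> X) = k \<and> x \<in> X \<and> x \<notin> set c}"
  define b where "b = Max ?B"
  have finB: "finite ?B"
  proof (rule finite_subset)
    have "card (nbrs x \<inter> set c) \<le> card Y" if "x \<in> X" for x c
      using nbrs_subset[OF that] finY by (intro card_mono) auto
    then show "?B \<subseteq> {..card Y}" by auto
  qed simp
  \<comment> \<open>No cycle covers \<open>X\<close>, so a longest cycle misses some vertex and the
    maximum \<open>b\<close> is attained.\<close>
  have neB: "?B \<noteq> {}" using c1 no[OF c1(1)] by blast
  have bmax: "card (nbrs x \<inter> set c) \<le> b"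
    if "cycle c" "card (set c \<inter> X) = k" "x \<in> X" "x \<notin> set c" for c x
    unfolding b_def using finB that by (intro Max_ge) blast+
  interpret extremal_bigraph G X Y \<delta> k b
    using deg kX card kmax bmax c0 by unfold_locales (auto intro: order_trans[OF c0(2) kmax])
  have "b \<in> ?B" unfolding b_def using finB neB by (rule Max_in)
  then obtain c x where cx: "cycle c" "card (set c \<inter> X) = k" "x \<in> X" "x \<notin> set c" "card (nbrs x \<inter> set c) = b"
    by blast
  show False
  proof (cases "b \<le> 1")
    case True
    obtain R p q where "ear c R p q" using ear_exists[OF 2 cx(1,3,4)] .
    then show False by (rule no_ear[OF True cx(1,2)])
  next
    case b2: False
    show False
    proof (cases "b < k")
      case True
      have "nbrs x \<inter> set c \<noteq> {}" using cx(5) b2 by (intro notI) simp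
      then obtain y where y: "y \<in> nbrs x" "y \<in> set c" by blast
      obtain d where d: "cycle (d @ [y])" "set (d @ [y]) = set c" using cycle_rotate_to_last[OF cx(1) y(2)] .
      have "G (last (d @ [y])) x" using y(1) sym[of x y] by (simp add: nbrs_def)
      then show False 
        using few_nbrs_on_path[OF d(1), unfolded d(2), OF cx(2-4) _ cx(5)] b2 True by simp
    next
      case False
      have sub: "nbrs x \<inter> set c \<subseteq> set c \<inter> Y" using nbrs_subset[OF cx(3)] by auto
      \<comment> \<open>Here \<open>k \<le> b\<close>, while \<open>c\<close> has exactly
        \<open>k\<close> vertices in \<open>Y\<close>: all of them are neighbours of
        \<open>x\<close>.\<close>
      have "card (set c \<inter> Y) \<le> card (nbrs x \<inter> set c)" using cycle_card[OF cx(1)] cx(2,5) False by simp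
      then have "nbrs x \<inter> set c = set c \<inter> Y" using sub by (intro card_seteq) auto
      then show False using not_all_neighbours[OF 2 cx(1-4)] by blast
    qed
  qed
qed

lemma cycle_parity:
  assumes "cycle c" "hd c \<in> X" "i < length c"
  shows "c ! i \<in> (if even i then X else Y)"
  using assms(3)
proof (induction i)
  case 0
  then show ?case using assms(2) by (simp add: hd_conv_nth)
next
  case (Suc i)
  then have "G (c ! i) (c ! Suc i)"
    using assms(1) by (auto simp: cycle_def path_def successively_conv_nth)
  then show ?case using Suc adj_X adj_Y by (auto split: if_splits)
qed

end

section \<open>Back to hypergraphs\<close>

lemma berge_cycle_of_incidence_cycle:
  assumes "bigraph (inc_adj V E) (Inl ` V) (Inr ` E)"
    and "bigraph.cycle (inc_adj V E) c" "Inl ` V \<subseteq> set c" "V \<noteq> {}"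
  shows "hamiltonian_berge_cycle V E"
proof -
  interpret bigraph "inc_adj V E" "Inl ` V" "Inr ` E" by (rule assms(1))
  have "set c \<inter> Inl ` V \<noteq> {}" using assms(3,4) by blast
  then have "card (set c \<inter> Inl ` V) \<noteq> 0" by simp
  then have "set c \<inter> Inr ` E \<noteq> {}" using cycle_card[OF assms(2)] by (metis card.empty)
  then obtain y where y: "y \<in> set c" "y \<in> Inr ` E" by blast
  obtain d' where d': "cycle (d' @ [y])" "set (d' @ [y]) = set c" using cycle_rotate_to_last[OF assms(2) y(1)] .
  define d where "d = d' @ [y]"
  have d: "cycle d" "set d = set c" "last d \<in> Inr ` E" using d' y by (auto simp: d_def)
  have closed: "inc_adj V E (last d) (hd d)" using d(1) by (simp add: cycle_def)
  have hd: "hd d \<in> Inl ` V" using adj_X[OF closed d(3)] .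
  have ne: "d \<noteq> []" and dist: "distinct d" and len3: "3 \<le> length d"
    and suc: "\<And>i. Suc i < length d \<Longrightarrow> inc_adj V E (d ! i) (d ! Suc i)"
    using d(1) by (auto simp: cycle_def path_def successively_conv_nth)
  have par: "d ! i \<in> Inl ` V" if "i < length d" "even i" for i
    using cycle_parity[OF d(1) hd that(1)] that(2) by simp
  have par': "d ! i \<in> Inr ` E" if "i < length d" "odd i" for i
    using cycle_parity[OF d(1) hd that(1)] that(2) by simp
  have "last d = d ! (length d - 1)" using ne by (simp add: last_conv_nth)
  then have "d ! (length d - 1) \<notin> Inl ` V" using d(3) by auto
  then have "odd (length d - 1)" using par[of "length d - 1"] ne by (metis One_nat_def diff_less length_greater_0_conv lessI)
  moreover have "Suc (length d - 1) = length d" using ne by simp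
  ultimately have "even (length d)" by (metis even_Suc)
  then obtain l where l: "length d = 2 * l" by blast
  have l2: "2 \<le> l" using len3 l by simp
  define vs es where "vs = map (\<lambda>i. projl (d ! (2 * i))) [0..<l]"
    and "es = map (\<lambda>i. projr (d ! (2 * i + 1))) [0..<l]"
  have vs: "Inl (vs ! i) = d ! (2 * i)" and es: "Inr (es ! i) = d ! (2 * i + 1)" if "i < l" for i
    using par[of "2 * i"] par'[of "2 * i + 1"] that l by (auto simp: vs_def es_def)
  have len: "length vs = l" "length es = l" by (simp_all add: vs_def es_def)
  have "berge_cycle V E vs es"
    unfolding berge_cycle_def len
  proof (intro conjI allI impI)
    show "1 \<le> l" using l2 by simp
    show "distinct vs" unfolding distinct_conv_nth len
    proof (intro allI impI)
      fix i j assume ij: "i < l" "j < l" "i \<noteq> j"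
      then have "d ! (2 * i) \<noteq> d ! (2 * j)" using dist l by (simp add: nth_eq_iff_index_eq)
      then show "vs ! i \<noteq> vs ! j" using vs[OF ij(1)] vs[OF ij(2)] by metis
    qed
    show "distinct es" unfolding distinct_conv_nth len
    proof (intro allI impI)
      fix i j assume ij: "i < l" "j < l" "i \<noteq> j"
      then have "d ! (2 * i + 1) \<noteq> d ! (2 * j + 1)" using dist l by (simp add: nth_eq_iff_index_eq)
      then show "es ! i \<noteq> es ! j" using es[OF ij(1)] es[OF ij(2)] by metis
    qed
    show "set vs \<subseteq> V"
    proof
      fix v assume "v \<in> set vs"
      then obtain i where "i < l" "v = vs ! i" by (auto simp: in_set_conv_nth len)
      then show "v \<in> V" using par[of "2 * i"] vs[of i] l by auto
    qed
    show "set es \<subseteq> E"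
    proof
      fix e assume "e \<in> set es"
      then obtain i where "i < l" "e = es ! i" by (auto simp: in_set_conv_nth len)
      then show "e \<in> E" using par'[of "2 * i + 1"] es[of i] l by auto
    qed
    fix i assume i: "i < l"
    have "inc_adj V E (d ! (2 * i)) (d ! (2 * i + 1))" using suc[of "2 * i"] i l by simp
    then show "vs ! i \<in> es ! i" using vs[OF i, symmetric] es[OF i, symmetric] by (auto simp: inc_adj_def)
    show "vs ! ((i + 1) mod l) \<in> es ! i"
    proof (cases "i + 1 < l")
      case True
      then have "inc_adj V E (d ! (2 * i + 1)) (d ! (2 * (i + 1)))" using suc[of "2 * i + 1"] l by simp
      then show ?thesis using vs[OF True, symmetric] es[OF i, symmetric] True by (auto simp: inc_adj_def)
    next
      case False
      then have il: "i + 1 = l" using i by simp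
      \<comment> \<open>The last edge wraps around to \<open>vs ! 0\<close> through the closing
        adjacency of \<open>d\<close>.\<close>
      then have "2 * i + 1 = length d - 1" using l by simp
      then have "last d = d ! (2 * i + 1)" "hd d = d ! (2 * 0)" using ne by (simp_all add: last_conv_nth hd_conv_nth)
      then have "inc_adj V E (Inr (es ! i)) (Inl (vs ! 0))"
        using closed es[OF i] vs[of 0] l2 by simp
      then show ?thesis using il by (auto simp: inc_adj_def)
    qed
  qed (simp_all add: len)
  moreover have "V \<subseteq> set vs"
  proof
    fix v assume "v \<in> V"
    then have "Inl v \<in> set d" using assms(3) d(2) by blast
    then obtain i where i: "i < length d" "d ! i = Inl v" by (auto simp: in_set_conv_nth)
    then have "even i" using par'[of i] by auto
    then obtain j where j: "i = 2 * j" by blast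
    then have "Inl (vs ! j) = Inl v" "j < l" using i l vs[of j] by auto
    then show "v \<in> set vs" using len(1) by (metis nth_mem sum.inject(1))
  qed
  ultimately show ?thesis unfolding hamiltonian_berge_cycle_def berge_cycle_def by blast
qed

theorem theorem4:
  fixes V :: "'a set" and E :: "'a set set" and n m :: nat and \<delta> :: int
  assumes "hypergraph V E" and "finite V"
    and "card V = n" and "card E = m"
    and "\<delta> \<ge> int n" and "real_of_int \<delta> \<ge> (real m + 5) / 3"
    and "two_connected_hypergraph V E"
    and "\<forall>v\<in>V. int (hdegree E v) \<ge> \<delta>"
  shows "hamiltonian_berge_cycle V E"
proof -
  have EV: "E \<subseteq> Pow V" using assms(1) by (auto simp: hypergraph_def)
  then have finE: "finite E" using assms(2) finite_subset by blast
  interpret bigraph "inc_adj V E" "Inl ` V" "Inr ` E"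
    by unfold_locales (use assms(2) finE in \<open>auto simp: inc_adj_def\<close>)
  have two: "two_connected_graph (inc_adj V E) (Inl ` V \<union> Inr ` E)"
    using assms(7) by (simp add: two_connected_hypergraph_def inc_vertices_def)
  have Vne: "V \<noteq> {}"
  proof
    assume V: "V = {}"
    \<comment> \<open>The only possible edge is the empty set, but the incidence graph has at least
      three vertices.\<close>
    then have "Inl ` V \<union> Inr ` E \<subseteq> {Inr {}}" using EV by auto
    then have "card (Inl ` V \<union> Inr ` E) \<le> card {Inr {} :: 'a + 'a set}" by (intro card_mono) simp_all
    then show False using two by (simp add: two_connected_graph_def)
  qed
  then obtain v where v: "v \<in> V" by blast
  have "real_of_int (int m + 5) \<le> real_of_int (3 * \<delta>)" using assms(6) by (simp add: field_simps)
  then have m: "int m + 5 \<le> 3 * \<delta>" by (simp only: of_int_le_iff)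
  have "hdegree E v \<le> m" unfolding hdegree_def assms(4)[symmetric] using finE by (intro card_mono) auto
  \<comment> \<open>A degree is at most the number of edges, so
    \<open>\<delta> \<le> m \<le> 3 * \<delta> - 5\<close> and \<open>\<delta>\<close> is at least
    5/2.\<close>
  then have \<delta>3: "3 \<le> \<delta>" using m assms(8) v by fastforce
  \<comment> \<open>There are no repeated edges, so degree 3 requires at least three vertices.\<close>
  have "{e \<in> E. v \<in> e} \<subseteq> insert v ` Pow (V - {v})"
  proof
    fix e assume "e \<in> {e \<in> E. v \<in> e}"
    then have "e = insert v (e - {v})" "e - {v} \<in> Pow (V - {v})" using EV by auto
    then show "e \<in> insert v ` Pow (V - {v})" by blast
  qed
  then have "hdegree E v \<le> card (insert v ` Pow (V - {v}))"
    unfolding hdegree_def using assms(2) by (intro card_mono) auto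
  also have "\<dots> \<le> card (Pow (V - {v}))" using assms(2) by (intro card_image_le) auto
  also have "\<dots> = 2 ^ (n - 1)" using assms(2,3) v by (simp add: card_Pow)
  finally have deg_v: "hdegree E v \<le> 2 ^ (n - 1)" .
  have n3: "3 \<le> n"
  proof (rule ccontr)
    assume "\<not> 3 \<le> n"
    then have "(2 :: nat) ^ (n - 1) \<le> 2 ^ 1" by (intro power_increasing) auto
    then show False using deg_v \<delta>3 assms(8) v by fastforce
  qed
  have nb: "nbrs (Inl u) = Inr ` {e \<in> E. u \<in> e}" if "u \<in> V" for u
    using that by (auto simp: nbrs_def inc_adj_def)
  obtain c where c: "cycle c" "Inl ` V \<subseteq> set c"
  proof (rule spanning_cycle[OF two, of "nat \<delta>"])
    show "3 \<le> card (Inl ` V)" using n3 assms(3) by (simp add: card_image)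
    show "card (Inl ` V) \<le> nat \<delta>" using assms(3,5) by (simp add: card_image)
    show "card (Inr ` E) + 5 \<le> 3 * nat \<delta>" using m assms(4) by (simp add: card_image)
    show "nat \<delta> \<le> card (nbrs x)" if "x \<in> Inl ` V" for x
      using that assms(8) nb by (auto simp: card_image hdegree_def)
  qed
  show ?thesis by (rule berge_cycle_of_incidence_cycle[OF bigraph_axioms c Vne])
qed

end
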